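(* Let $P=\{p_1,\dots,p_n\}\subset\mathbb{R}^2$ be in general position and let $f_{ij}=\det(a,p_i,p_j)\det(b,p_i,p_j)$ for fixed $a,b\in\mathbb{R}^2$. Let $Y\subset\mathbb{R}^{\binom n2}$, with coordinates $d_{ij}=d_{ji}$, be defined by: for every four distinct indices $i,j,k,l$, $\sum w_{\alpha\beta}d_{\alpha\beta}=1$, the sum over the six pairs $\alpha\beta$ from $\{i,j,k,l\}$, with $w_{\alpha\beta}=1/(\det(p_\alpha,p_\beta,p_\gamma)\det(p_\alpha,p_\beta,p_\delta))$ where $\{\gamma,\delta\}=\{i,j,k,l\}\setminus\{\alpha,\beta\}$; and $d_{ij}\le0$ for all pairs. Then $Y$ is a simple polyhedron, affinely isomorphic to $\bar X_f(P)$ via $v\mapsto d$, $d_{ij}=f_{ij}-\langle p_i-p_j,v_i-v_j\rangle$. Its unique maximal bounded face is obtained by setting $d_{ij}=0$ for all convex hull edges $ij$ of $P$, and this face is affinely isomorphic to $X_f(P)$.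
   Context: General position: no three points collinear. $\det(q_0,q_1,q_2)$ is the determinant of the $3\times3$ matrix with columns $(q_0,1),(q_1,1),(q_2,1)$. Infinitesimal motions $v\in(\mathbb{R}^2)^n$ are normalized by $v_1^1=v_1^2=v_2^1=0$ (with $p_1,p_2$ having different $y$-coordinates). $\bar X_f(P)$ is the set of normalized $v$ with $\langle p_i-p_j,v_i-v_j\rangle\ge f_{ij}$ for all $i<j$; $X_f(P)$ is its subset where the inequalities for the convex hull edges of $P$ hold with equality. *)

theory Defs
  imports "HOL-Analysis.Analysis"
begin

text \<open>det(q0,q1,q2): determinant of the 3x3 matrix with columns (q0,1),(q1,1),(q2,1),
  written out explicitly.\<close>
definition det3 :: "real^2 \<Rightarrow> real^2 \<Rightarrow> real^2 \<Rightarrow> real" where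
  "det3 q0 q1 q2 = (q1$1 - q0$1) * (q2$2 - q0$2) - (q2$1 - q0$1) * (q1$2 - q0$2)"

definition general_position :: "('n::finite \<Rightarrow> real^2) \<Rightarrow> bool" where
  "general_position p \<longleftrightarrow> inj p \<and>
     (\<forall>i j k. i \<noteq> j \<and> i \<noteq> k \<and> j \<noteq> k \<longrightarrow> det3 (p i) (p j) (p k) \<noteq> 0)"

definition fval :: "real^2 \<Rightarrow> real^2 \<Rightarrow> ('n::finite \<Rightarrow> real^2) \<Rightarrow> 'n \<Rightarrow> 'n \<Rightarrow> real" where
  "fval a b p i j = det3 a (p i) (p j) * det3 b (p i) (p j)"

definition hull_edge :: "('n::finite \<Rightarrow> real^2) \<Rightarrow> 'n \<Rightarrow> 'n \<Rightarrow> bool" where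
  "hull_edge p i j \<longleftrightarrow> i \<noteq> j \<and> convex hull {p i, p j} face_of convex hull (range p)"

text \<open>Xbar_f(P): normalized infinitesimal motions (normalization at the two
  distinguished indices o1, o2, playing the roles of p_1, p_2).\<close>
definition Xbar :: "('n \<Rightarrow> 'n \<Rightarrow> real) \<Rightarrow> ('n::finite \<Rightarrow> real^2) \<Rightarrow> 'n \<Rightarrow> 'n \<Rightarrow> (real^2^'n) set" where
  "Xbar f p o1 o2 = {v. v$o1$1 = 0 \<and> v$o1$2 = 0 \<and> v$o2$1 = 0 \<and>
      (\<forall>i j. i \<noteq> j \<longrightarrow> (p i - p j) \<bullet> (v$i - v$j) \<ge> f i j)}"

definition Xf :: "('n \<Rightarrow> 'n \<Rightarrow> real) \<Rightarrow> ('n::finite \<Rightarrow> real^2) \<Rightarrow> 'n \<Rightarrow> 'n \<Rightarrow> (real^2^'n) set" where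
  "Xf f p o1 o2 = {v \<in> Xbar f p o1 o2.
      \<forall>i j. hull_edge p i j \<longrightarrow> (p i - p j) \<bullet> (v$i - v$j) = f i j}"

definition wterm :: "('n::finite \<Rightarrow> real^2) \<Rightarrow> real^('n \<times> 'n) \<Rightarrow> 'n \<Rightarrow> 'n \<Rightarrow> 'n \<Rightarrow> 'n \<Rightarrow> real" where
  "wterm p d a b c e = d$(a,b) / (det3 (p a) (p b) (p c) * det3 (p a) (p b) (p e))"

definition quad_sum :: "('n::finite \<Rightarrow> real^2) \<Rightarrow> real^('n \<times> 'n) \<Rightarrow> 'n \<Rightarrow> 'n \<Rightarrow> 'n \<Rightarrow> 'n \<Rightarrow> real" where
  "quad_sum p d i j k l = wterm p d i j k l + wterm p d i k j l + wterm p d i l j k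
     + wterm p d j k i l + wterm p d j l i k + wterm p d k l i j"

text \<open>Y, with the coordinates d_{ij} (i,j unordered) encoded as a symmetric
  array with zero diagonal in real^('n \<times> 'n).\<close>
definition Yset :: "('n::finite \<Rightarrow> real^2) \<Rightarrow> (real^('n \<times> 'n)) set" where
  "Yset p = {d. (\<forall>i j. d$(i,j) = d$(j,i)) \<and> (\<forall>i. d$(i,i) = 0) \<and>
      (\<forall>i j k l. distinct [i,j,k,l] \<longrightarrow> quad_sum p d i j k l = 1) \<and>
      (\<forall>i j. i \<noteq> j \<longrightarrow> d$(i,j) \<le> 0)}"

definition dmap :: "('n \<Rightarrow> 'n \<Rightarrow> real) \<Rightarrow> ('n::finite \<Rightarrow> real^2) \<Rightarrow> real^2^'n \<Rightarrow> real^('n \<times> 'n)" where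
  "dmap f p v = (\<chi> ij. f (fst ij) (snd ij) - (p (fst ij) - p (snd ij)) \<bullet> (v$(fst ij) - v$(snd ij)))"

definition affine_map :: "('a::real_vector \<Rightarrow> 'b::real_vector) \<Rightarrow> bool" where
  "affine_map g \<longleftrightarrow> (\<exists>L c. linear L \<and> g = (\<lambda>x. L x + c))"

definition simple_polyhedron :: "'a::euclidean_space set \<Rightarrow> bool" where
  "simple_polyhedron S \<longleftrightarrow> polyhedron S \<and>
     (\<forall>x. x extreme_point_of S \<longrightarrow> int (card {F. F facet_of S \<and> x \<in> F}) = aff_dim S)"

end

theory Submission
  imports Defs
begin

text \<open>
  On four points, the equation defining \<open>Y\<close> pairs \<open>d\<close> with the (up to scaling unique) self-stress of the complete
  graph on them; infinitesimal motions are annihilated by it, and \<open>f\<close> is normalised to the value 1. This gives the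
  affine isomorphism. The signs of the coefficients show that the tight edges of a point of \<open>Y\<close> neither cross nor
  positively span the plane at a vertex: they form a pointed noncrossing graph.

  A pointed noncrossing graph carries no self-stress: the Maxwell lifting of a stress is piecewise linear with
  creases only along edges and vanishes outside the convex hull; at a maximum there is a direction along which it is
  locally affine, so maxima propagate outwards, and the lifting is zero. Hence tight constraints are linearly
  independent, which is simplicity. A hull edge can be added to a pointed noncrossing graph, so independence forces
  every hull edge to be tight at an extreme point, and bounded faces are hulls of extreme points. Conversely, an
  expansive motion preserving the lengths of the hull edges is rigid, so the face they define is bounded.
\<close>

section \<open>Self-stresses of pointed noncrossing graphs\<close>

text \<open>The Maxwell lifting is usually built face by face over a planar subdivision, whose faces
  would have to be constructed. The formula by separated pairs avoids them: it makes sense for any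
  symmetric weights, and each property of the lifting becomes visible for a suitable line through
  the point. A line that misses the point set shows that the value is zero, the line joining two
  points shows continuity, and at a maximum the line is chosen so that no edge creases the lifting
  along it.

  Independence is used in dual form: for each edge of a pointed noncrossing graph there is a motion
  that changes this edge to first order and no other edge of the graph. At an extreme point of
  \<open>Y\<close> these motions give a basis of the direction space, which counts the facets; for a
  hull edge that is not tight, the same kind of motion contradicts extremality. For boundedness, a
  unit recession direction of the face is read as an expansive motion.\<close>

definition cross2 :: "real^2 \<Rightarrow> real^2 \<Rightarrow> real" where
  "cross2 u w = u$1 * w$2 - u$2 * w$1"

lemma det3_cross2: "det3 x y z = cross2 (y - x) (z - x)"
  by (simp add: det3_def cross2_def algebra_simps)

lemma det3_cyclic: "det3 y z x = det3 x y z"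
  by (simp add: det3_def algebra_simps)

lemma det3_swap: "det3 x z y = - det3 x y z"
  by (simp add: det3_def algebra_simps)

lemma cross2_self [simp]: "cross2 u u = 0"
  and cross2_zero_left [simp]: "cross2 0 u = 0"
  and cross2_zero_right [simp]: "cross2 u 0 = 0"
  by (simp_all add: cross2_def)

lemma cross2_add_right: "cross2 u (v + w) = cross2 u v + cross2 u w"
  and cross2_diff_right: "cross2 u (v - w) = cross2 u v - cross2 u w"
  and cross2_scale_right: "cross2 u (c *\<^sub>R w) = c * cross2 u w"
  and cross2_commute: "cross2 u w = - cross2 w u"
  by (simp_all add: cross2_def algebra_simps)

lemma abs_cross2_le: "\<bar>cross2 u w\<bar> \<le> 2 * (norm u * norm w)"
proof -
  have "\<bar>cross2 u w\<bar> \<le> \<bar>u$1\<bar> * \<bar>w$2\<bar> + \<bar>u$2\<bar> * \<bar>w$1\<bar>"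
    unfolding cross2_def by (metis abs_mult abs_triangle_ineq4)
  also have "\<dots> \<le> norm u * norm w + norm u * norm w"
    by (intro add_mono mult_mono component_le_norm_cart) auto
  finally show ?thesis by simp
qed

text \<open>A nonzero vector is parallel to at most one of the pairwise non-parallel directions
  (1,0), (1,1), (1,2), (0,1), so one of them is transversal to both vectors. It serves as an
  intermediate direction between two parallel ones.\<close>

lemma cross2_nonzero_exists:
  assumes "u \<noteq> 0" "w \<noteq> 0"
  obtains y where "cross2 u y \<noteq> 0" "cross2 w y \<noteq> 0" "y \<noteq> 0"
proof -
  have "\<exists>y. cross2 u y \<noteq> 0 \<and> cross2 w y \<noteq> 0"
  proof (rule ccontr)
    assume N: "\<not> ?thesis"
    define m :: "real \<Rightarrow> real^2" where "m t = (\<chi> i. if i = 1 then 1 else t)" for t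
    have "cross2 u (m t) * cross2 w (m t) = 0" for t using N by auto
    from this[of 0] this[of 1] this[of 2] have
      "u$2 * w$2 = 0" "(u$1 - u$2) * (w$1 - w$2) = 0" "(u$1*2 - u$2) * (w$1*2 - w$2) = 0"
      by (auto simp: m_def cross2_def)
    moreover have "u$1 \<noteq> 0 \<or> u$2 \<noteq> 0" "w$1 \<noteq> 0 \<or> w$2 \<noteq> 0"
      using assms by (auto simp: vec_eq_iff forall_2)
    moreover have "cross2 u (\<chi> i. if i = 1 then 0 else 1) * cross2 w (\<chi> i. if i = 1 then 0 else 1) = 0"
      using N by auto
    ultimately show False by (auto simp: cross2_def)
  qed
  then show ?thesis using that by (metis cross2_zero_right)
qed

section \<open>The Maxwell lifting of a self-stress\<close>

definition stress :: "('n::finite \<Rightarrow> real^2) \<Rightarrow> ('n \<Rightarrow> 'n \<Rightarrow> real) \<Rightarrow> bool" where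
  "stress p \<omega> \<longleftrightarrow> (\<forall>i j. \<omega> i j = \<omega> j i) \<and> (\<forall>i. (\<Sum>j\<in>UNIV. \<omega> i j *\<^sub>R (p j - p i)) = 0)"

text \<open>Twice the Maxwell lifting of \<open>\<omega>\<close>, written as a sum over the pairs separated by the line through \<open>x\<close> in
  direction \<open>u\<close>. Equilibrium makes the value independent of \<open>u\<close>, and along that line the separated pairs
  do not change.\<close>

definition lift :: "('n::finite \<Rightarrow> real^2) \<Rightarrow> ('n \<Rightarrow> 'n \<Rightarrow> real) \<Rightarrow> real^2 \<Rightarrow> real^2 \<Rightarrow> real" where
  "lift p \<omega> u x = (\<Sum>k\<in>UNIV. \<Sum>l\<in>UNIV.
     if (cross2 u (p k - x) \<ge> 0) \<noteq> (cross2 u (p l - x) \<ge> 0) then \<omega> k l * \<bar>det3 x (p k) (p l)\<bar> else 0)"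

text \<open>Each summand is the moment about \<open>x\<close> of a force acting at
  \<open>p k\<close>; the forces at \<open>p k\<close> have resultant zero, hence so have their
  moments.\<close>

lemma stress_moment:
  assumes "stress p \<omega>"
  shows "(\<Sum>l\<in>UNIV. \<omega> k l * det3 x (p k) (p l)) = 0"
proof -
  have "(\<Sum>l\<in>UNIV. \<omega> k l * det3 x (p k) (p l)) = cross2 (p k - x) (\<Sum>l\<in>UNIV. \<omega> k l *\<^sub>R (p l - p k))"
  proof -
    have "cross2 (p k - x) (\<Sum>l\<in>UNIV. \<omega> k l *\<^sub>R (p l - p k)) =
      (\<Sum>l\<in>UNIV. cross2 (p k - x) (\<omega> k l *\<^sub>R (p l - p k)))"
      by (simp add: cross2_def sum_distrib_left sum_subtractf)
    also have "\<dots> = (\<Sum>l\<in>UNIV. \<omega> k l * det3 x (p k) (p l))"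
      by (intro sum.cong refl) (simp add: cross2_def det3_def algebra_simps)
    finally show ?thesis by simp
  qed
  moreover have "(\<Sum>l\<in>UNIV. \<omega> k l *\<^sub>R (p l - p k)) = 0" using assms unfolding stress_def by blast
  ultimately show ?thesis by simp
qed

text \<open>Here \<open>a\<close>, \<open>a'\<close> locate two points relative to one line through
  \<open>x\<close>, and \<open>b\<close>, \<open>b'\<close> relative to another. Separation of the
  pair changes exactly when one of the two points lies in the double wedge between the lines, and
  then the sign of \<open>d\<close> is known. This replaces the absolute value by a signed area
  times a difference of two terms, each depending on one point only.\<close>

lemma separation_change:
  fixes a b a' b' d D :: real
  assumes "D * d = a * b' - b * a'" "D \<noteq> 0"
  shows "\<bar>d\<bar> * (of_bool ((a \<ge> 0) \<noteq> (a' \<ge> 0)) - of_bool ((b \<ge> 0) \<noteq> (b' \<ge> 0)))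
    = sgn D * d * (of_bool ((a \<ge> 0) = (b \<ge> 0)) - of_bool ((a' \<ge> 0) = (b' \<ge> 0)))"
proof -
  have s: "\<bar>d\<bar> = sgn D * d" if "D * d \<ge> 0"
    using that assms(2) by (cases "D > 0") (auto simp: zero_le_mult_iff sgn_if)
  have t: "\<bar>d\<bar> = - (sgn D * d)" if "D * d \<le> 0"
    using that assms(2) by (cases "D > 0") (auto simp: mult_le_0_iff sgn_if)
  have m: "x * y \<ge> 0" if "x \<ge> 0 \<and> y \<ge> 0 \<or> x \<le> 0 \<and> y \<le> 0" for x y :: real
    using that by (auto simp: zero_le_mult_iff)
  have n: "x * y \<le> 0" if "x \<ge> 0 \<and> y \<le> 0 \<or> x \<le> 0 \<and> y \<ge> 0" for x y :: real
    using that by (auto simp: mult_le_0_iff)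
  show ?thesis
  proof (cases "(a \<ge> 0) = (b \<ge> 0)"; cases "(a' \<ge> 0) = (b' \<ge> 0)")
    assume 1: "(a \<ge> 0) = (b \<ge> 0)" "(a' \<ge> 0) \<noteq> (b' \<ge> 0)"
    show ?thesis
    proof (cases "(a \<ge> 0) = (a' \<ge> 0)")
      case True
      then have "a * b' \<le> 0" "b * a' \<ge> 0" using 1 by (auto intro!: m n)
      then have "D * d \<le> 0" using assms by simp
      with True 1 t show ?thesis by auto
    next
      case False
      then have "a * b' \<ge> 0" "b * a' \<le> 0" using 1 by (auto intro!: m n)
      then have "D * d \<ge> 0" using assms by simp
      with False 1 s show ?thesis by auto
    qed
  next
    assume 1: "(a \<ge> 0) \<noteq> (b \<ge> 0)" "(a' \<ge> 0) = (b' \<ge> 0)"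
    show ?thesis
    proof (cases "(a \<ge> 0) = (a' \<ge> 0)")
      case True
      then have "a * b' \<ge> 0" "b * a' \<le> 0" using 1 by (auto intro!: m n)
      then have "D * d \<ge> 0" using assms by simp
      with True 1 s show ?thesis by auto
    next
      case False
      then have "a * b' \<le> 0" "b * a' \<ge> 0" using 1 by (auto intro!: m n)
      then have "D * d \<le> 0" using assms by simp
      with False 1 t show ?thesis by auto
    qed
  qed auto
qed

text \<open>By \<open>separation_change\<close> the difference is a signed sum whose factor splits
  as \<open>?g k - ?g l\<close>; summing over the other index first leaves row and column sums of
  moments, which vanish.\<close>

lemma lift_cong_transversal:
  assumes st: "stress p \<omega>" and D: "cross2 u w \<noteq> 0"
  shows "lift p \<omega> u x = lift p \<omega> w x"
proof -
  let ?a = "\<lambda>k. cross2 u (p k - x)" and ?b = "\<lambda>k. cross2 w (p k - x)"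
  let ?g = "\<lambda>k. of_bool ((?a k \<ge> 0) = (?b k \<ge> 0)) :: real"
  let ?d = "\<lambda>k l. det3 x (p k) (p l)"
  have sym: "\<omega> k l = \<omega> l k" for k l using st by (simp add: stress_def)
  have col: "(\<Sum>k\<in>UNIV. \<omega> k l * ?d k l) = 0" for l
  proof -
    have "\<omega> k l * ?d k l = - (\<omega> l k * ?d l k)" for k
      using sym[of k l] det3_swap[of x "p k" "p l"] by simp
    then show ?thesis using stress_moment[OF st, of l x] by (simp only: sum_negf)
  qed
  have "lift p \<omega> u x - lift p \<omega> w x =
    (\<Sum>k\<in>UNIV. \<Sum>l\<in>UNIV. \<omega> k l * (\<bar>?d k l\<bar> * (of_bool ((?a k \<ge> 0) \<noteq> (?a l \<ge> 0)) - of_bool ((?b k \<ge> 0) \<noteq> (?b l \<ge> 0)))))"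
    unfolding lift_def sum_subtractf[symmetric] by (intro sum.cong refl) (simp only: of_bool_def split: if_split, simp)
  also have "\<dots> = (\<Sum>k\<in>UNIV. \<Sum>l\<in>UNIV. \<omega> k l * (sgn (cross2 u w) * ?d k l * (?g k - ?g l)))"
  proof (intro sum.cong refl, subst separation_change)
    show "cross2 u w * ?d k l = ?a k * ?b l - ?b k * ?a l" for k l
      by (simp add: cross2_def det3_def algebra_simps)
  qed (use D in simp_all)
  also have "\<dots> = (\<Sum>k\<in>UNIV. sgn (cross2 u w) * ?g k * (\<Sum>l\<in>UNIV. \<omega> k l * ?d k l))
     - (\<Sum>l\<in>UNIV. sgn (cross2 u w) * ?g l * (\<Sum>k\<in>UNIV. \<omega> k l * ?d k l))"
  proof -
    have "(\<Sum>l\<in>UNIV. sgn (cross2 u w) * ?g l * (\<Sum>k\<in>UNIV. \<omega> k l * ?d k l)) =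
      (\<Sum>k\<in>UNIV. \<Sum>l\<in>UNIV. sgn (cross2 u w) * ?g l * (\<omega> k l * ?d k l))"
      unfolding sum_distrib_left by (rule sum.swap)
    then show ?thesis
      by (simp only: sum_distrib_left sum_subtractf[symmetric])
         (intro sum.cong refl, simp add: algebra_simps)
  qed
  finally show ?thesis using stress_moment[OF st] col by simp
qed

lemma lift_cong_direction:
  assumes "stress p \<omega>" "u \<noteq> 0" "w \<noteq> 0"
  shows "lift p \<omega> u x = lift p \<omega> w x"
proof -
  obtain y where "cross2 u y \<noteq> 0" "cross2 w y \<noteq> 0"
    using cross2_nonzero_exists assms by metis
  then show ?thesis using lift_cong_transversal[OF assms(1)] by metis
qed

lemma det3_move: "det3 (x + t *\<^sub>R u) y z = det3 x y z + t * cross2 u (y - z)"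
  by (simp add: det3_def cross2_def algebra_simps)

lemma lift_along_direction:
  "lift p \<omega> u (x + t *\<^sub>R u) = (\<Sum>k\<in>UNIV. \<Sum>l\<in>UNIV.
     if (cross2 u (p k - x) \<ge> 0) \<noteq> (cross2 u (p l - x) \<ge> 0)
     then \<omega> k l * \<bar>det3 x (p k) (p l) + t * cross2 u (p k - p l)\<bar> else 0)"
proof -
  have "cross2 u (q - (x + t *\<^sub>R u)) = cross2 u (q - x)" for q
    by (simp add: cross2_def algebra_simps)
  then show ?thesis unfolding lift_def det3_move by simp
qed

text \<open>Both values are computed with the direction \<open>y - x\<close>. For it the separated
  pairs at \<open>x\<close> and \<open>y\<close> are the same, so only the areas change and the case
  distinction causes no jump.\<close>

lemma lift_lipschitz:
  assumes "stress p \<omega>" "w \<noteq> 0"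
  shows "\<bar>lift p \<omega> w y - lift p \<omega> w x\<bar> \<le> (\<Sum>k\<in>UNIV. \<Sum>l\<in>UNIV. \<bar>\<omega> k l\<bar> * (2 * norm (p k - p l))) * norm (y - x)"
proof (cases "y = x")
  case False
  let ?u = "y - x"
  have u: "?u \<noteq> 0" using False by simp
  have "\<bar>lift p \<omega> w y - lift p \<omega> w x\<bar> = \<bar>lift p \<omega> ?u (x + 1 *\<^sub>R ?u) - lift p \<omega> ?u (x + 0 *\<^sub>R ?u)\<bar>"
    using lift_cong_direction[OF assms(1) u assms(2)] by simp
  also have "\<dots> \<le> (\<Sum>k\<in>UNIV. \<Sum>l\<in>UNIV. \<bar>\<omega> k l\<bar> * (2 * norm (p k - p l) * norm ?u))"
    unfolding lift_along_direction sum_subtractf[symmetric]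
  proof (intro sum_abs[THEN order_trans] sum_mono)
    fix k l
    have "\<bar>\<omega> k l * \<bar>det3 x (p k) (p l) + 1 * cross2 ?u (p k - p l)\<bar> - \<omega> k l * \<bar>det3 x (p k) (p l) + 0 * cross2 ?u (p k - p l)\<bar>\<bar>
      = \<bar>\<omega> k l\<bar> * \<bar>\<bar>det3 x (p k) (p l) + cross2 ?u (p k - p l)\<bar> - \<bar>det3 x (p k) (p l)\<bar>\<bar>"
      by (simp add: abs_mult[symmetric] algebra_simps)
    also have "\<dots> \<le> \<bar>\<omega> k l\<bar> * (2 * norm (p k - p l) * norm ?u)"
      using abs_cross2_le[of ?u "p k - p l"] by (intro mult_left_mono) (auto simp: mult_ac)
    finally show "\<bar>(if (cross2 ?u (p k - x) \<ge> 0) \<noteq> (cross2 ?u (p l - x) \<ge> 0)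
     then \<omega> k l * \<bar>det3 x (p k) (p l) + 1 * cross2 ?u (p k - p l)\<bar> else 0)
      - (if (cross2 ?u (p k - x) \<ge> 0) \<noteq> (cross2 ?u (p l - x) \<ge> 0)
     then \<omega> k l * \<bar>det3 x (p k) (p l) + 0 * cross2 ?u (p k - p l)\<bar> else 0)\<bar>
     \<le> \<bar>\<omega> k l\<bar> * (2 * norm (p k - p l) * norm ?u)" by auto
  qed
  finally show ?thesis unfolding sum_distrib_right by (simp only: mult.assoc)
qed simp

lemma continuous_on_lift:
  assumes "stress p \<omega>" "w \<noteq> 0"
  shows "continuous_on S (lift p \<omega> w)"
proof -
  let ?K = "\<Sum>k\<in>UNIV. \<Sum>l\<in>UNIV. \<bar>\<omega> k l\<bar> * (2 * norm (p k - p l))"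
  have "?K-lipschitz_on S (lift p \<omega> w)"
    using lift_lipschitz[OF assms]
    by (intro lipschitz_onI) (auto simp: dist_norm norm_minus_commute intro!: sum_nonneg)
  then show ?thesis by (rule lipschitz_on_continuous_on)
qed

text \<open>The line through \<open>x\<close> perpendicular to the vector \<open>x\<close> has all
  points strictly on one side, so no pair is separated.\<close>

lemma lift_outside:
  assumes "stress p \<omega>" "w \<noteq> 0" "\<And>k. norm (p k) < norm x"
  shows "lift p \<omega> w x = 0"
proof -
  define u :: "real^2" where "u = (\<chi> i. if i = 1 then x$2 else - x$1)"
  have x: "x \<noteq> 0" using assms(3)[of undefined] by (metis norm_not_less_zero norm_zero)
  then have "u \<noteq> 0" by (auto simp: u_def vec_eq_iff forall_2)
  then have eq: "lift p \<omega> w x = lift p \<omega> u x" using lift_cong_direction assms by metis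
  have "cross2 u (p k - x) < 0" for k
  proof -
    have "cross2 u (p k - x) = x \<bullet> p k - x \<bullet> x"
      by (auto simp: u_def cross2_def inner_vec_def sum_2 algebra_simps)
    moreover have "x \<bullet> p k < x \<bullet> x"
    proof -
      have "x \<bullet> p k \<le> norm x * norm (p k)" by (rule norm_cauchy_schwarz)
      also have "\<dots> < norm x * norm x" using assms(3)[of k] x by simp
      finally show ?thesis by (simp add: dot_square_norm power2_eq_square)
    qed
    ultimately show ?thesis by simp
  qed
  then have "\<not> 0 \<le> cross2 u (p k - x)" for k by (simp add: not_le)
  then have "lift p \<omega> u x = 0" unfolding lift_def by simp
  with eq show ?thesis by simp
qed

text \<open>If \<open>t\<close> is small, the absolute value of a nonzero area is affine on the
  whole step and cancels. Only pairs collinear with \<open>z\<close> survive: they are the creases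
  met at \<open>z\<close>.\<close>

lemma lift_second_difference:
  "\<exists>t>0. lift p \<omega> u (z + t *\<^sub>R u) + lift p \<omega> u (z - t *\<^sub>R u) - 2 * lift p \<omega> u z =
    (\<Sum>k\<in>UNIV. \<Sum>l\<in>UNIV.
      if (cross2 u (p k - z) \<ge> 0) \<noteq> (cross2 u (p l - z) \<ge> 0) \<and> det3 z (p k) (p l) = 0
      then 2 * t * \<omega> k l * \<bar>cross2 u (p k - p l)\<bar> else 0)"
proof -
  let ?d = "\<lambda>k l. det3 z (p k) (p l)" and ?c = "\<lambda>k l. cross2 u (p k - p l)"
  have "\<forall>\<^sub>F t in at_right (0::real). \<forall>k l. ?d k l \<noteq> 0 \<longrightarrow> t * \<bar>?c k l\<bar> \<le> \<bar>?d k l\<bar>"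
  proof (intro eventually_all_finite)
    fix k l
    show "\<forall>\<^sub>F t in at_right (0::real). ?d k l \<noteq> 0 \<longrightarrow> t * \<bar>?c k l\<bar> \<le> \<bar>?d k l\<bar>"
    proof (cases "?d k l = 0")
      case False
      show ?thesis unfolding eventually_at_right_field
      proof (intro exI[of _ "\<bar>?d k l\<bar> / (\<bar>?c k l\<bar> + 1)"] conjI allI impI)
        fix t assume t: "0 < t" "t < \<bar>?d k l\<bar> / (\<bar>?c k l\<bar> + 1)"
        then have "t * (\<bar>?c k l\<bar> + 1) < \<bar>?d k l\<bar>"
          by (simp add: pos_less_divide_eq add_nonneg_pos)
        then show "t * \<bar>?c k l\<bar> \<le> \<bar>?d k l\<bar>" using t by (simp add: algebra_simps)
      qed (use False in \<open>auto intro!: divide_pos_pos\<close>)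
    qed simp
  qed
  then have "\<forall>\<^sub>F t in at_right (0::real). t > 0 \<and> (\<forall>k l. ?d k l \<noteq> 0 \<longrightarrow> t * \<bar>?c k l\<bar> \<le> \<bar>?d k l\<bar>)"
    using eventually_at_right_less by (rule eventually_conj[rotated])
  then obtain t where t: "t > 0" "\<And>k l. ?d k l \<noteq> 0 \<Longrightarrow> t * \<bar>?c k l\<bar> \<le> \<bar>?d k l\<bar>"
    using eventually_happens'[OF trivial_limit_at_right_real] by blast
  have m: "\<bar>d + e\<bar> + \<bar>d - e\<bar> = 2 * \<bar>d\<bar>" if "\<bar>e\<bar> \<le> \<bar>d\<bar>" for d e :: real
    using that by arith
  have mm: "\<bar>?d k l + t * ?c k l\<bar> + \<bar>?d k l + (- t) * ?c k l\<bar> - 2 * \<bar>?d k l\<bar> =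
    (if ?d k l = 0 then 2 * t * \<bar>?c k l\<bar> else 0)" for k l
    using t(1) t(2)[of k l] m[of "t * ?c k l" "?d k l"] by (auto simp: abs_mult)
  have l0: "lift p \<omega> u z = lift p \<omega> u (z + 0 *\<^sub>R u)" by simp
  have lm: "lift p \<omega> u (z - t *\<^sub>R u) = lift p \<omega> u (z + (- t) *\<^sub>R u)" by simp
  show ?thesis
  proof (intro exI[of _ t] conjI t(1))
    show "lift p \<omega> u (z + t *\<^sub>R u) + lift p \<omega> u (z - t *\<^sub>R u) - 2 * lift p \<omega> u z =
    (\<Sum>k\<in>UNIV. \<Sum>l\<in>UNIV.
      if (cross2 u (p k - z) \<ge> 0) \<noteq> (cross2 u (p l - z) \<ge> 0) \<and> ?d k l = 0
      then 2 * t * \<omega> k l * \<bar>?c k l\<bar> else 0)"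
      unfolding l0 lm lift_along_direction sum.distrib[symmetric] sum_subtractf[symmetric] sum_distrib_left
    proof (intro sum.cong refl)
      fix k l
      have "\<omega> k l * (\<bar>?d k l + t * ?c k l\<bar> + \<bar>?d k l + (- t) * ?c k l\<bar> - 2 * \<bar>?d k l\<bar>) =
        \<omega> k l * (if ?d k l = 0 then 2 * t * \<bar>?c k l\<bar> else 0)" by (simp only: mm)
      then show "(if (cross2 u (p k - z) \<ge> 0) \<noteq> (cross2 u (p l - z) \<ge> 0) then \<omega> k l * \<bar>?d k l + t * ?c k l\<bar> else 0) +
         (if (cross2 u (p k - z) \<ge> 0) \<noteq> (cross2 u (p l - z) \<ge> 0) then \<omega> k l * \<bar>?d k l + (- t) * ?c k l\<bar> else 0) -
         2 * (if (cross2 u (p k - z) \<ge> 0) \<noteq> (cross2 u (p l - z) \<ge> 0) then \<omega> k l * \<bar>?d k l + 0 * ?c k l\<bar> else 0) =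
         (if (cross2 u (p k - z) \<ge> 0) \<noteq> (cross2 u (p l - z) \<ge> 0) \<and> ?d k l = 0 then 2 * t * \<omega> k l * \<bar>?c k l\<bar> else 0)"
        by (auto simp: algebra_simps split: if_splits)
    qed
  qed
qed

section \<open>Edges through a point\<close>

lemma cross2_both_zero:
  assumes "cross2 u w \<noteq> 0" "cross2 u m = 0" "cross2 w m = 0"
  shows "m = 0"
proof -
  have "cross2 u w *\<^sub>R m = cross2 u m *\<^sub>R w - cross2 w m *\<^sub>R u"
    by (simp add: vec_eq_iff forall_2 cross2_def algebra_simps)
  then show ?thesis using assms by simp
qed

text \<open>With offsets \<open>A \<ge> 0\<close> and \<open>B < 0\<close> from the line,
  \<open>z\<close> divides the segment with weights \<open>- B / (A - B)\<close> and
  \<open>A / (A - B)\<close>.\<close>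

lemma separated_collinear_in_segment:
  assumes "(cross2 u (y - z) \<ge> 0) \<noteq> (cross2 u (w - z) \<ge> 0)" "det3 z y w = 0"
  shows "z \<in> closed_segment y w"
proof -
  have *: "z \<in> closed_segment y w" if a: "cross2 u (y - z) \<ge> 0" and b: "cross2 u (w - z) < 0"
    and d: "det3 z y w = 0" for y w
  proof -
    define A B where "A = cross2 u (y - z)" and "B = cross2 u (w - z)"
    have AB: "A \<ge> 0" "B < 0" using a b by (auto simp: A_def B_def)
    have "A *\<^sub>R (w - z) - B *\<^sub>R (y - z) = 0"
    proof (rule cross2_both_zero[of u "w - z"])
      show "cross2 (w - z) (A *\<^sub>R (w - z) - B *\<^sub>R (y - z)) = 0"
        using d cross2_commute[of "w - z" "y - z"]
        by (simp only: cross2_diff_right[of _ "_ *\<^sub>R _"] cross2_scale_right det3_cross2) simp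
    qed (use b in \<open>auto simp: A_def B_def cross2_diff_right cross2_scale_right\<close>)
    then have "(A - B) *\<^sub>R z = (- B) *\<^sub>R y + A *\<^sub>R w" by (simp add: algebra_simps)
    then have "(1 / (A - B)) *\<^sub>R ((A - B) *\<^sub>R z) = (1 / (A - B)) *\<^sub>R ((- B) *\<^sub>R y + A *\<^sub>R w)" by (rule arg_cong)
    then have "z = (- B / (A - B)) *\<^sub>R y + (A / (A - B)) *\<^sub>R w"
      using AB by (simp add: scaleR_diff_right)
    moreover have "- B / (A - B) = 1 - A / (A - B)" using AB by (simp add: field_simps)
    ultimately show ?thesis unfolding in_segment
      using AB by (intro exI[of _ "A / (A - B)"]) (auto simp: field_simps)
  qed
  show ?thesis
  proof (cases "cross2 u (y - z) \<ge> 0")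
    case True then show ?thesis using * assms by auto
  next
    case False
    then have "z \<in> closed_segment w y" using *[of w y] assms det3_swap[of z y w] by auto
    then show ?thesis by (simp add: closed_segment_commute)
  qed
qed

text \<open>The sign condition describes a proper crossing of two disjoint edges; edges with a
  common endpoint cannot meet elsewhere in general position. Pointedness is stated as a closed
  half-plane containing all edges at the vertex.\<close>

definition pointed_noncrossing :: "('n::finite \<Rightarrow> real^2) \<Rightarrow> ('n \<Rightarrow> 'n \<Rightarrow> bool) \<Rightarrow> bool" where
  "pointed_noncrossing p E \<longleftrightarrow>
    (\<forall>i j. E i j \<longrightarrow> E j i \<and> i \<noteq> j) \<and>
    (\<forall>i j k l. E i j \<and> E k l \<and> distinct [i, j, k, l] \<longrightarrow>
      \<not> (det3 (p i) (p j) (p k) * det3 (p i) (p j) (p l) < 0 \<and>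
         det3 (p k) (p l) (p i) * det3 (p k) (p l) (p j) < 0)) \<and>
    (\<forall>i. \<exists>u. u \<noteq> 0 \<and> (\<forall>j. E i j \<longrightarrow> cross2 u (p j - p i) \<ge> 0))"

lemma pointed_noncrossing_edge:
  "\<lbrakk>pointed_noncrossing p E; E i j\<rbrakk> \<Longrightarrow> E j i \<and> i \<noteq> j"
  unfolding pointed_noncrossing_def by blast

lemma det3_convex_comb:
  "det3 x y ((1 - t) *\<^sub>R z + t *\<^sub>R w) = (1 - t) * det3 x y z + t * det3 x y w"
  by (simp add: det3_def algebra_simps)

lemma det3_repeat [simp]: "det3 x x y = 0" "det3 x y x = 0" "det3 y x x = 0"
  by (simp_all add: det3_def algebra_simps)

lemma general_position_det3:
  "\<lbrakk>general_position p; i \<noteq> j; i \<noteq> k; j \<noteq> k\<rbrakk> \<Longrightarrow> det3 (p i) (p j) (p k) \<noteq> 0"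
  by (simp add: general_position_def)

lemma vertex_in_segment:
  assumes "general_position p" "k \<noteq> l" "p i \<in> closed_segment (p k) (p l)"
  shows "i = k \<or> i = l"
proof -
  obtain t where "p i = (1 - t) *\<^sub>R p k + t *\<^sub>R p l" using assms(3) by (auto simp: in_segment)
  then have "det3 (p k) (p l) (p i) = 0" by (simp add: det3_convex_comb)
  then show ?thesis using general_position_det3[OF assms(1), of k l i] assms(2) by auto
qed

lemma convex_comb_zero_opposite:
  fixes x y t :: real
  assumes "(1 - t) * x + t * y = 0" "0 \<le> t" "t \<le> 1" "x \<noteq> 0" "y \<noteq> 0"
  shows "x * y < 0"
proof -
  have t: "t \<noteq> 0" "t \<noteq> 1" using assms by auto
  then have "0 < t" "t < 1" using assms by auto
  have "t * (x * y) = - ((1 - t) * (x * x))" using assms(1) by algebra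
  moreover have "(1 - t) * (x * x) > 0" using \<open>t < 1\<close> assms(4) by (simp add: power2_eq_square[symmetric])
  ultimately have "t * (x * y) < 0" by simp
  then show ?thesis using \<open>0 < t\<close> by (simp add: mult_less_0_iff)
qed

text \<open>The area over one edge vanishes at \<open>z\<close>, which is a convex combination of
  the ends of the other; nonzero areas at these ends must have opposite signs. Doing this for both
  edges gives a forbidden crossing.\<close>

lemma noncrossing_segments:
  assumes gp: "general_position p" and E: "pointed_noncrossing p E" "E i j" "E k l"
    and z: "z \<in> open_segment (p i) (p j)" "z \<in> closed_segment (p k) (p l)"
  shows "{i, j} = {k, l}"
proof (rule ccontr)
  assume ne: "{i, j} \<noteq> {k, l}"
  have d: "i \<noteq> j" "k \<noteq> l" using pointed_noncrossing_edge[OF E(1)] E(2,3) by blast+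
  obtain t where t: "z = (1 - t) *\<^sub>R p i + t *\<^sub>R p j" "0 < t" "t < 1" using z(1) by (auto simp: in_segment)
  obtain s where s: "z = (1 - s) *\<^sub>R p k + s *\<^sub>R p l" "0 \<le> s" "s \<le> 1" using z(2) by (auto simp: in_segment)
  have "det3 (p k) (p l) z = 0" unfolding s by (simp add: det3_convex_comb)
  then have A: "(1 - t) * det3 (p k) (p l) (p i) + t * det3 (p k) (p l) (p j) = 0"
    unfolding t by (simp add: det3_convex_comb)
  have "det3 (p i) (p j) z = 0" unfolding t by (simp add: det3_convex_comb)
  then have B: "(1 - s) * det3 (p i) (p j) (p k) + s * det3 (p i) (p j) (p l) = 0"
    unfolding s by (simp add: det3_convex_comb)
  have nz: "det3 (p k) (p l) (p m) \<noteq> 0" if "m \<noteq> k" "m \<noteq> l" for m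
    using general_position_det3[OF gp] d that by metis
  \<comment> \<open>A common endpoint removes one term of \<open>A\<close>; the remaining term has a
    nonzero factor \<open>t\<close> or \<open>1 - t\<close>, so its area vanishes and the edges
    coincide.\<close>
  have ij: "i \<noteq> k" "i \<noteq> l" "j \<noteq> k" "j \<noteq> l"
    using A nz[of i] nz[of j] t(2,3) ne d by (auto simp: doubleton_eq_iff)
  have "det3 (p k) (p l) (p i) * det3 (p k) (p l) (p j) < 0"
    using convex_comb_zero_opposite[OF A] t nz ij by auto
  moreover have "det3 (p i) (p j) (p k) * det3 (p i) (p j) (p l) < 0"
    using convex_comb_zero_opposite[OF B] s general_position_det3[OF gp] ij d by auto
  moreover have "distinct [i, j, k, l]" using ij d by auto
  ultimately show False using E unfolding pointed_noncrossing_def by blast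
qed

lemma lift_nonpos:
  assumes gp: "general_position p" and st: "stress p \<omega>" and pn: "pointed_noncrossing p E"
    and supp: "\<And>i j. \<omega> i j \<noteq> 0 \<Longrightarrow> E i j" and w: "w \<noteq> 0"
  shows "lift p \<omega> w x \<le> 0"
proof (rule ccontr)
  assume "\<not> ?thesis"
  then have pos: "lift p \<omega> w x > 0" by simp
  define R where "R = Max (range (\<lambda>k. norm (p k)))"
  have R: "norm (p k) \<le> R" for k unfolding R_def by simp
  have inR: "y \<in> cball 0 R" if "lift p \<omega> w y > 0" for y
  proof (rule ccontr)
    assume "y \<notin> cball 0 R"
    then have "norm (p k) < norm y" for k using R[of k] by simp
    then show False using lift_outside[OF st w, of y] that by simp
  qed
  have "cball 0 R \<noteq> ({} :: (real^2) set)" using inR[OF pos] by blast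
  then obtain z0 where z0: "z0 \<in> cball 0 R" "\<And>y. y \<in> cball 0 R \<Longrightarrow> lift p \<omega> w y \<le> lift p \<omega> w z0"
    using continuous_attains_sup[OF compact_cball _ continuous_on_lift[OF st w]] by metis
  define M where "M = lift p \<omega> w z0"
  have Mpos: "M > 0" using z0(2)[OF inR[OF pos]] pos by (simp add: M_def)
  \<comment> \<open>The maximum on the ball is global: positive values occur only in the
    ball.\<close>
  have M: "lift p \<omega> w y \<le> M" for y
    using z0(2)[of y] inR[of y] Mpos by (cases "lift p \<omega> w y > 0") (auto simp: M_def)
  let ?S = "{y \<in> cball 0 R. lift p \<omega> w y = M}"
  have "closed ?S"
    using continuous_closed_preimage_constant[OF continuous_on_lift[OF st w], of "cball 0 R" M] by simp
  then have "compact ?S"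
    by (metis (no_types, lifting) bounded_cball bounded_subset compact_eq_bounded_closed mem_Collect_eq subsetI)
  moreover have "?S \<noteq> {}" using z0(1) by (auto simp: M_def)
  \<comment> \<open>Among the maximum points the one farthest from the origin is taken, so that the
    maximum cannot spread in both directions along a line through it.\<close>
  ultimately obtain z where z: "z \<in> ?S" "\<And>y. y \<in> ?S \<Longrightarrow> norm y \<le> norm z"
    using continuous_attains_sup[of ?S norm] continuous_on_norm_id by blast
  have zM: "lift p \<omega> w z = M" and zmax: "\<And>y. lift p \<omega> w y = M \<Longrightarrow> norm y \<le> norm z"
    using z inR Mpos by auto
  \<comment> \<open>At a vertex \<open>u\<close> bounds the half-plane of its edges, inside an edge
    \<open>u\<close> is the direction of that edge, elsewhere any direction works. Since offset 0
    counts as the nonnegative side, edges starting at the vertex, or lying in the line, are not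
    separated.\<close>
  have "\<exists>u. u \<noteq> 0 \<and> (\<forall>k l. E k l \<and> (cross2 u (p k - z) \<ge> 0) \<noteq> (cross2 u (p l - z) \<ge> 0) \<longrightarrow> det3 z (p k) (p l) \<noteq> 0)"
  proof (cases "\<exists>i. z = p i")
    case True
    then obtain i where i: "z = p i" by blast
    obtain u where u: "u \<noteq> 0" "\<And>j. E i j \<Longrightarrow> cross2 u (p j - p i) \<ge> 0"
      using pn unfolding pointed_noncrossing_def by blast
    show ?thesis
    proof (intro exI[of _ u] conjI u(1) allI impI notI)
      fix k l assume H: "E k l \<and> (cross2 u (p k - z) \<ge> 0) \<noteq> (cross2 u (p l - z) \<ge> 0)" "det3 z (p k) (p l) = 0"
      then have "z \<in> closed_segment (p k) (p l)" using separated_collinear_in_segment by blast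
      moreover have kl: "k \<noteq> l" "E l k" using pointed_noncrossing_edge[OF pn] H by blast+
      ultimately have "i = k \<or> i = l" using vertex_in_segment[OF gp, of k l i] i by simp
      then show False using H kl u(2) i by auto
    qed
  next
    case notv: False
    show ?thesis
    proof (cases "\<exists>i j. E i j \<and> z \<in> open_segment (p i) (p j)")
      case True
      then obtain i j where ij: "E i j" "z \<in> open_segment (p i) (p j)" by blast
      let ?u = "p j - p i"
      obtain t where t: "z = (1 - t) *\<^sub>R p i + t *\<^sub>R p j" "p i \<noteq> p j" using ij(2) by (auto simp: in_segment)
      have c: "cross2 ?u (p i - z) = 0" "cross2 ?u (p j - z) = 0"
        unfolding t by (simp_all add: cross2_def algebra_simps)
      show ?thesis
      proof (intro exI[of _ ?u] conjI allI impI notI)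
        fix k l assume H: "E k l \<and> (cross2 ?u (p k - z) \<ge> 0) \<noteq> (cross2 ?u (p l - z) \<ge> 0)" "det3 z (p k) (p l) = 0"
        then have "z \<in> closed_segment (p k) (p l)" using separated_collinear_in_segment by blast
        then have "{i, j} = {k, l}" using noncrossing_segments[OF gp pn ij(1) _ ij(2)] H by blast
        then show False using H c by (auto simp: doubleton_eq_iff)
      qed (use t(2) in auto)
    next
      case False
      have "det3 z (p k) (p l) \<noteq> 0"
        if "E k l" "(cross2 w (p k - z) \<ge> 0) \<noteq> (cross2 w (p l - z) \<ge> 0)" for k l
        using separated_collinear_in_segment[OF that(2)] that(1) False notv
        by (auto simp: open_segment_def)
      then show ?thesis using w by blast
    qed
  qed
  then obtain u where u: "u \<noteq> 0"
    and nk: "\<And>k l. E k l \<Longrightarrow> (cross2 u (p k - z) \<ge> 0) \<noteq> (cross2 u (p l - z) \<ge> 0) \<Longrightarrow> det3 z (p k) (p l) \<noteq> 0"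
    by blast
  have eq: "lift p \<omega> u y = lift p \<omega> w y" for y using lift_cong_direction[OF st u w] .
  obtain t where t: "t > 0" and "lift p \<omega> w (z + t *\<^sub>R u) + lift p \<omega> w (z - t *\<^sub>R u) - 2 * lift p \<omega> w z =
    (\<Sum>k\<in>UNIV. \<Sum>l\<in>UNIV.
      if (cross2 u (p k - z) \<ge> 0) \<noteq> (cross2 u (p l - z) \<ge> 0) \<and> det3 z (p k) (p l) = 0
      then 2 * t * \<omega> k l * \<bar>cross2 u (p k - p l)\<bar> else 0)" (is "_ = ?T")
    using lift_second_difference[of p \<omega> u z] unfolding eq by blast
  moreover have "?T = 0" by (intro sum.neutral ballI) (use nk supp in auto)
  ultimately have "lift p \<omega> w (z + t *\<^sub>R u) + lift p \<omega> w (z - t *\<^sub>R u) = 2 * M" using zM by simp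
  then have "lift p \<omega> w (z + t *\<^sub>R u) = M" "lift p \<omega> w (z - t *\<^sub>R u) = M"
    using M[of "z + t *\<^sub>R u"] M[of "z - t *\<^sub>R u"] by linarith+
  then have "norm (z + t *\<^sub>R u) \<le> norm z" "norm (z - t *\<^sub>R u) \<le> norm z" using zmax by auto
  then have "(z + t *\<^sub>R u) \<bullet> (z + t *\<^sub>R u) \<le> z \<bullet> z" "(z - t *\<^sub>R u) \<bullet> (z - t *\<^sub>R u) \<le> z \<bullet> z"
    by (simp_all add: norm_le)
  then have "(z + t *\<^sub>R u) \<bullet> (z + t *\<^sub>R u) + (z - t *\<^sub>R u) \<bullet> (z - t *\<^sub>R u) \<le> 2 * (z \<bullet> z)" by linarith
  \<comment> \<open>Parallelogram law: \<open>z + t *\<^sub>R u\<close> and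
    \<open>z - t *\<^sub>R u\<close> cannot both be at most as far out as \<open>z\<close>.\<close>
  then have "t * t * (u \<bullet> u) \<le> 0" by (simp add: algebra_simps inner_commute)
  moreover have "t * t * (u \<bullet> u) > 0" using t u by (intro mult_pos_pos) auto
  ultimately show False by linarith
qed

lemma lift_minus: "lift p (\<lambda>i j. - \<omega> i j) w x = - lift p \<omega> w x"
  unfolding lift_def sum_negf[symmetric] by (intro sum.cong refl) auto

text \<open>Applied to \<omega> and its negative, \<open>lift_nonpos\<close> makes the lifting zero.
  The weight of an edge is then recovered from the crease at its midpoint, which no other edge
  contains.\<close>

theorem pointed_noncrossing_stress_free:
  assumes gp: "general_position p" and st: "stress p \<omega>" and pn: "pointed_noncrossing p E"
    and supp: "\<And>i j. \<omega> i j \<noteq> 0 \<Longrightarrow> E i j"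
  shows "\<omega> i j = 0"
proof (rule ccontr)
  assume nz: "\<omega> i j \<noteq> 0"
  then have Eij: "E i j" "E j i" "i \<noteq> j" using supp pointed_noncrossing_edge[OF pn] by blast+
  have st': "stress p (\<lambda>i j. - \<omega> i j)" using st unfolding stress_def scaleR_minus_left sum_negf by simp
  define z where "z = midpoint (p i) (p j)"
  define e where "e = p j - p i"
  define u :: "real^2" where "u = (\<chi> m. if m = 1 then e$2 else - e$1)"
  have e: "e \<noteq> 0" using gp Eij by (auto simp: general_position_def e_def dest: injD)
  have ce: "cross2 u e = e \<bullet> e" by (simp add: u_def cross2_def inner_vec_def sum_2)
  have pe: "cross2 u e > 0" using e ce by simp
  then have u: "u \<noteq> 0" by auto
  have z0: "lift p \<omega> u y = 0" for y
    using lift_nonpos[OF gp st pn supp u, of y] lift_nonpos[OF gp st' pn _ u, of y] supp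
    unfolding lift_minus by fastforce
  have zs: "z \<in> open_segment (p i) (p j)"
    using e by (auto simp: z_def e_def)
  have zi: "p i - z = (- 1/2) *\<^sub>R e" and zj: "p j - z = (1/2) *\<^sub>R e"
    by (auto simp: z_def e_def midpoint_def vec_eq_iff forall_2 field_simps)
  obtain t where t: "t > 0" and eq: "0 =
    (\<Sum>k\<in>UNIV. \<Sum>l\<in>UNIV.
      if (cross2 u (p k - z) \<ge> 0) \<noteq> (cross2 u (p l - z) \<ge> 0) \<and> det3 z (p k) (p l) = 0
      then 2 * t * \<omega> k l * \<bar>cross2 u (p k - p l)\<bar> else 0)" (is "_ = (\<Sum>k\<in>UNIV. \<Sum>l\<in>UNIV. ?T k l)")
    using lift_second_difference[of p \<omega> u z] unfolding z0 diff_self add_0 mult_zero_right by blast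
  note eq
  also have "(\<Sum>k\<in>UNIV. \<Sum>l\<in>UNIV. ?T k l) = (\<Sum>x\<in>UNIV. ?T (fst x) (snd x))"
    by (simp add: sum.cartesian_product split_beta flip: UNIV_Times_UNIV)
  also have "\<dots> = (\<Sum>x\<in>{(i, j), (j, i)}. ?T (fst x) (snd x))"
  proof (intro sum.mono_neutral_right ballI)
    fix x assume "x \<in> UNIV - {(i, j), (j, i)}"
    moreover obtain k l where x: "x = (k, l)" by (cases x)
    ultimately have "{i, j} \<noteq> {k, l}" by (auto simp: doubleton_eq_iff)
    then have "?T k l = 0"
      using noncrossing_segments[OF gp pn Eij(1) _ zs, of k l] supp[of k l]
        separated_collinear_in_segment[of u "p k" z "p l"] by auto
    then show "?T (fst x) (snd x) = 0" unfolding x fst_conv snd_conv .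
  qed auto
  also have "\<dots> = ?T i j + ?T j i" using Eij(3) by simp
  \<comment> \<open>The factor 4 is the 2 of the second difference times the two orders of the pair.
    As \<open>u\<close> is perpendicular to the edge, its endpoints are separated.\<close>
  also have "\<dots> = 4 * t * \<omega> i j * cross2 u e"
  proof -
    have "det3 z (p i) (p j) = 0" "det3 z (p j) (p i) = 0"
      unfolding det3_cross2 zi zj by (simp_all add: cross2_def algebra_simps)
    moreover have "cross2 u (p i - z) < 0" "cross2 u (p j - z) > 0"
      unfolding zi zj cross2_scale_right using pe by auto
    moreover have "cross2 u (p j - p i) = cross2 u e" "cross2 u (p i - p j) = - cross2 u e"
      by (simp_all add: e_def cross2_def algebra_simps)
    moreover have "\<omega> j i = \<omega> i j" using st by (simp add: stress_def)
    ultimately show ?thesis using pe by simp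
  qed
  finally show False using t nz pe by simp
qed


section \<open>Distance coordinates of infinitesimal motions\<close>

text \<open>The signed triangle areas \<open>\<lambda>\<close> are the coefficients of the affine dependence of the four points, and
  \<open>\<lambda>\<^sub>\<alpha> \<lambda>\<^sub>\<beta>\<close> is the self-stress of the complete graph on them.\<close>

lemma quad_sum_eq:
  fixes p :: "'n::finite \<Rightarrow> real^2"
  assumes gp: "general_position p" and d: "distinct [i, j, k, l]"
  defines "a \<equiv> det3 (p j) (p k) (p l)" and "b \<equiv> - det3 (p i) (p k) (p l)"
    and "c \<equiv> det3 (p i) (p j) (p l)" and "e \<equiv> - det3 (p i) (p j) (p k)"
  shows "quad_sum p x i j k l = - (a*b*x$(i,j) + a*c*x$(i,k) + a*e*x$(i,l) + b*c*x$(j,k) + b*e*x$(j,l) + c*e*x$(k,l)) / (a*b*c*e)"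
    and "a * b * c * e \<noteq> 0"
proof -
  have nz: "a \<noteq> 0" "b \<noteq> 0" "c \<noteq> 0" "e \<noteq> 0"
    using general_position_det3[OF gp] d by (auto simp: a_def b_def c_def e_def)
  have "det3 (p i) (p j) (p k) = - e" "det3 (p i) (p j) (p l) = c" "det3 (p i) (p k) (p j) = e"
    "det3 (p i) (p k) (p l) = - b" "det3 (p i) (p l) (p j) = - c" "det3 (p i) (p l) (p k) = b"
    "det3 (p j) (p k) (p i) = - e" "det3 (p j) (p k) (p l) = a" "det3 (p j) (p l) (p i) = c"
    "det3 (p j) (p l) (p k) = - a" "det3 (p k) (p l) (p i) = - b" "det3 (p k) (p l) (p j) = a"
    by (simp_all add: a_def b_def c_def e_def det3_def algebra_simps)
  then show "quad_sum p x i j k l = - (a*b*x$(i,j) + a*c*x$(i,k) + a*e*x$(i,l) + b*c*x$(j,k) + b*e*x$(j,l) + c*e*x$(k,l)) / (a*b*c*e)"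
    using nz by (simp add: quad_sum_def wterm_def field_simps)
  show "a * b * c * e \<noteq> 0" using nz by simp
qed

lemma affine_dependence:
  fixes i j k l :: "real^2"
  defines "a \<equiv> det3 j k l" and "b \<equiv> - det3 i k l"
    and "c \<equiv> det3 i j l" and "e \<equiv> - det3 i j k"
  shows "a + b + c + e = 0" "a * i$m + b * j$m + c * k$m + e * l$m = 0"
proof -
  show "a + b + c + e = 0" by (simp add: a_def b_def c_def e_def det3_def algebra_simps)
  show "a * i$m + b * j$m + c * k$m + e * l$m = 0" 
    using exhaust_2[of m] by (auto simp: a_def b_def c_def e_def det3_def algebra_simps)
qed

text \<open>The rigidity map of the complete graph: half the first-order change of the squared
  distances.\<close>

definition rig :: "('n::finite \<Rightarrow> real^2) \<Rightarrow> real^2^'n \<Rightarrow> real^('n \<times> 'n)" where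
  "rig p v = (\<chi> ij. (p (fst ij) - p (snd ij)) \<bullet> (v$(fst ij) - v$(snd ij)))"

lemma rig_nth [simp]: "rig p v $ (i, j) = (p i - p j) \<bullet> (v$i - v$j)"
  by (simp add: rig_def)

lemma linear_rig: "linear (rig p)"
  by (rule linearI) (simp_all add: vec_eq_iff rig_def inner_diff_right inner_add_right algebra_simps)

lemma dmap_eq: "dmap f p v = (\<chi> ij. f (fst ij) (snd ij)) - rig p v"
  by (simp add: dmap_def rig_def vec_eq_iff)

lemma affine_map_dmap: "affine_map (dmap f p)"
proof -
  have "linear (\<lambda>v. - rig p v)" by (rule linear_compose_neg[OF linear_rig])
  moreover have "dmap f p = (\<lambda>v. - rig p v + (\<chi> ij. f (fst ij) (snd ij)))"
    by (rule ext) (simp add: dmap_eq)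
  ultimately show ?thesis unfolding affine_map_def by blast
qed

text \<open>Lagrange's identity: with \<lambda> for the four coefficients, the sum equals (sum
  \<lambda>)(sum \<lambda> x v) - (sum \<lambda> x)(sum \<lambda> v), and the first factors
  vanish.\<close>

lemma affine_dependence_stress:
  fixes a b c e :: real
  assumes "a + b + c + e = 0" "a * x1 + b * x2 + c * x3 + e * x4 = 0"
  shows "a*b*((x1-x2)*(v1-v2)) + a*c*((x1-x3)*(v1-v3)) + a*e*((x1-x4)*(v1-v4)) + b*c*((x2-x3)*(v2-v3))
    + b*e*((x2-x4)*(v2-v4)) + c*e*((x3-x4)*(v3-v4)) = 0"
  using assms by algebra

lemma quad_sum_rig:
  assumes gp: "general_position p" and d: "distinct [i, j, k, l]"
  shows "quad_sum p (rig p v) i j k l = 0"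
proof -
  note dep = affine_dependence[of "p j" "p k" "p l" "p i"]
  note s1 = affine_dependence_stress[OF dep(1) dep(2)[of 1], of "v$i$1" "v$j$1" "v$k$1" "v$l$1"]
  note s2 = affine_dependence_stress[OF dep(1) dep(2)[of 2], of "v$i$2" "v$j$2" "v$k$2" "v$l$2"]
  show ?thesis unfolding quad_sum_eq(1)[OF gp d]
    using s1 s2 by (simp add: inner_vec_def sum_2 distrib_left)
qed

text \<open>The left side is the determinant of the 2x2 matrix that sums \<lambda> times the product
  of the offsets of each point from (s,t) and from (s',t'). By the affine dependence this matrix
  does not depend on the two base points. On the right both are moved to the fourth point, which
  removes three terms.\<close>

lemma affine_dependence_area:
  fixes a b c e :: real
  assumes "a + b + c + e = 0" "a * x1 + b * x2 + c * x3 + e * x4 = 0" "a * y1 + b * y2 + c * y3 + e * y4 = 0"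
  defines "D \<equiv> \<lambda>s t x y x' y'. (x - s) * (y' - t) - (x' - s) * (y - t)"
  shows "a*b*(D s t x1 y1 x2 y2 * D s' t' x1 y1 x2 y2) + a*c*(D s t x1 y1 x3 y3 * D s' t' x1 y1 x3 y3)
    + a*e*(D s t x1 y1 x4 y4 * D s' t' x1 y1 x4 y4) + b*c*(D s t x2 y2 x3 y3 * D s' t' x2 y2 x3 y3)
    + b*e*(D s t x2 y2 x4 y4 * D s' t' x2 y2 x4 y4) + c*e*(D s t x3 y3 x4 y4 * D s' t' x3 y3 x4 y4)
    = a*b*(D x4 y4 x1 y1 x2 y2)^2 + a*c*(D x4 y4 x1 y1 x3 y3)^2 + b*c*(D x4 y4 x2 y2 x3 y3)^2"
  unfolding D_def using assms(1-3) by algebra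

lemma quad_sum_fval:
  assumes gp: "general_position p" and d: "distinct [i, j, k, l]"
  shows "quad_sum p (\<chi> ij. fval a b p (fst ij) (snd ij)) i j k l = 1"
proof -
  define A B C E where AB: "A = det3 (p j) (p k) (p l)" "B = - det3 (p i) (p k) (p l)"
    "C = det3 (p i) (p j) (p l)" "E = - det3 (p i) (p j) (p k)"
  note dep = affine_dependence[of "p j" "p k" "p l" "p i", folded AB]
  have "A*B*fval a b p i j + A*C*fval a b p i k + A*E*fval a b p i l + B*C*fval a b p j k
     + B*E*fval a b p j l + C*E*fval a b p k l = A*B*C^2+A*C*B^2+B*C*A^2"
  proof -
    have sq: "C^2 = (det3 (p l) (p i) (p j))^2" "B^2 = (det3 (p l) (p i) (p k))^2" "A^2 = (det3 (p l) (p j) (p k))^2"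
      by (simp_all add: AB det3_def power2_eq_square algebra_simps)
    show ?thesis unfolding sq fval_def det3_def
      using affine_dependence_area[OF dep(1) dep(2)[of 1] dep(2)[of 2], of "a$1" "a$2" "b$1" "b$2"] by simp
  qed
  \<comment> \<open>The sum factors as ABC(A+B+C), and A+B+C = -E.\<close>
  also have "\<dots> = - (A*B*C*E)" using dep(1) by algebra
  finally show ?thesis unfolding quad_sum_eq(1)[OF gp d] 
    using quad_sum_eq(2)[OF gp d] by (simp add: AB)
qed


text \<open>The direction space of \<open>Yspace\<close>, given by the homogeneous equations. It
  turns out to be the image of \<open>rig\<close> on normalized motions.\<close>

definition motion_space :: "('n::finite \<Rightarrow> real^2) \<Rightarrow> (real^('n \<times> 'n)) set" where
  "motion_space p = {r. (\<forall>i j. r$(i,j) = r$(j,i)) \<and> (\<forall>i. r$(i,i) = 0) \<and>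
      (\<forall>i j k l. distinct [i,j,k,l] \<longrightarrow> quad_sum p r i j k l = 0)}"

definition Yspace :: "('n::finite \<Rightarrow> real^2) \<Rightarrow> (real^('n \<times> 'n)) set" where
  "Yspace p = {d. (\<forall>i j. d$(i,j) = d$(j,i)) \<and> (\<forall>i. d$(i,i) = 0) \<and>
      (\<forall>i j k l. distinct [i,j,k,l] \<longrightarrow> quad_sum p d i j k l = 1)}"

lemma Yset_eq: "Yset p = {d \<in> Yspace p. \<forall>i j. i \<noteq> j \<longrightarrow> d$(i,j) \<le> 0}"
  by (auto simp: Yset_def Yspace_def)

lemma quad_sum_add: "quad_sum p (x + y) i j k l = quad_sum p x i j k l + quad_sum p y i j k l"
  by (simp add: quad_sum_def wterm_def add_divide_distrib)

lemma quad_sum_diff: "quad_sum p (x - y) i j k l = quad_sum p x i j k l - quad_sum p y i j k l"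
  by (simp add: quad_sum_def wterm_def diff_divide_distrib)

lemma quad_sum_scaleR: "quad_sum p (c *\<^sub>R x) i j k l = c * quad_sum p x i j k l"
  by (simp add: quad_sum_def wterm_def distrib_left)

lemma linear_quad_sum: "linear (\<lambda>x. quad_sum p x i j k l)"
  by (rule linearI) (simp_all add: quad_sum_add quad_sum_scaleR)

lemma rig_in_motion_space: "general_position p \<Longrightarrow> rig p v \<in> motion_space p"
  by (auto simp: motion_space_def quad_sum_rig inner_diff_left inner_diff_right)

lemma subspace_motion_space: "subspace (motion_space p)"
proof (rule subspaceI)
  show "0 \<in> motion_space p" by (simp add: motion_space_def quad_sum_def wterm_def)
qed (simp_all add: motion_space_def quad_sum_add quad_sum_scaleR)

lemma Yspace_diff: "x \<in> Yspace p \<Longrightarrow> y \<in> Yspace p \<Longrightarrow> x - y \<in> motion_space p"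
  by (simp add: motion_space_def Yspace_def quad_sum_diff)

lemma Yspace_add: "x \<in> Yspace p \<Longrightarrow> r \<in> motion_space p \<Longrightarrow> x + r \<in> Yspace p"
  by (simp add: motion_space_def Yspace_def quad_sum_add)

lemma fval_in_Yspace: "general_position p \<Longrightarrow> (\<chi> ij. fval a b p (fst ij) (snd ij)) \<in> Yspace p"
  unfolding Yspace_def
  by (simp add: quad_sum_fval) (simp add: fval_def det3_def algebra_simps)

lemma dmap_in_Yspace: "general_position p \<Longrightarrow> dmap (fval a b p) p v \<in> Yspace p"
  unfolding dmap_eq
  using Yspace_add[OF fval_in_Yspace] subspace_neg[OF subspace_motion_space rig_in_motion_space]
  by fastforce

section \<open>Recovering a normalized motion from its edge values\<close>

lemma independent_inner_zero:
  fixes x y w :: "real^2"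
  assumes "cross2 x y \<noteq> 0" "x \<bullet> w = 0" "y \<bullet> w = 0"
  shows "w = 0"
proof -
  have "cross2 x y *\<^sub>R w = (\<chi> m. if m = 1 then (x \<bullet> w) * y$2 - (y \<bullet> w) * x$2 else (y \<bullet> w) * x$1 - (x \<bullet> w) * y$1)"
    by (simp add: vec_eq_iff forall_2 cross2_def inner_vec_def sum_2 algebra_simps)
  also have "\<dots> = 0" using assms by (simp add: vec_eq_iff)
  finally show ?thesis using assms(1) by simp
qed

lemma independent_inner_solve:
  fixes x y :: "real^2"
  assumes "cross2 x y \<noteq> 0"
  shows "\<exists>w. x \<bullet> w = s \<and> y \<bullet> w = t"
proof -
  define w :: "real^2" where "w = (1 / cross2 x y) *\<^sub>R (\<chi> m. if m = 1 then s * y$2 - t * x$2 else t * x$1 - s * y$1)"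
  have "x \<bullet> w = (1 / cross2 x y) * (cross2 x y * s)" "y \<bullet> w = (1 / cross2 x y) * (cross2 x y * t)"
    unfolding w_def inner_scaleR_right by (simp_all add: cross2_def inner_vec_def sum_2 algebra_simps)
  then show ?thesis using assms by auto
qed

definition normalized :: "'n \<Rightarrow> 'n \<Rightarrow> (real^2^'n::finite) set" where
  "normalized o1 o2 = {v. v$o1$1 = 0 \<and> v$o1$2 = 0 \<and> v$o2$1 = 0}"

lemma cross2_general_position:
  assumes "general_position p" "distinct [i, j, k]"
  shows "cross2 (p k - p i) (p k - p j) \<noteq> 0"
proof -
  have "cross2 (p k - p i) (p k - p j) = det3 (p k) (p i) (p j)"
    by (simp add: cross2_def det3_def algebra_simps)
  then show ?thesis using general_position_det3[OF assms(1)] assms(2) by auto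
qed

text \<open>The normalization leaves \<open>o2\<close> only a vertical velocity, which the
  non-horizontal edge to \<open>o1\<close> excludes. Every other point is then held by two
  non-parallel edges.\<close>

lemma rig_zero_on_triangles:
  assumes gp: "general_position p" and o: "o1 \<noteq> o2" "(p o1)$2 \<noteq> (p o2)$2"
    and v: "v \<in> normalized o1 o2" and r: "\<And>k. rig p v $ (k, o1) = 0" "\<And>k. rig p v $ (k, o2) = 0"
  shows "v = 0"
proof -
  have 1: "v$o1 = 0" using v by (auto simp: normalized_def vec_eq_iff forall_2)
  have "(p o2 - p o1) \<bullet> (v$o2 - v$o1) = 0" using r(1)[of o2] by simp
  then have "((p o2)$2 - (p o1)$2) * v$o2$2 = 0" using v by (simp add: 1 normalized_def inner_vec_def sum_2)
  then have 2: "v$o2 = 0" using o v by (auto simp: normalized_def vec_eq_iff forall_2)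
  have "v$k = 0" if "k \<noteq> o1" "k \<noteq> o2" for k
    by (rule independent_inner_zero[OF cross2_general_position[OF gp, of o1 o2 k]])
       (use that o r(1)[of k] r(2)[of k] 1 2 in auto)
  then have "v$k = 0" for k using 1 2 by (cases "k = o1"; cases "k = o2") auto
  then show ?thesis by (simp add: vec_eq_iff[of v])
qed

lemma inj_on_rig_normalized:
  assumes gp: "general_position p" and o: "o1 \<noteq> o2" "(p o1)$2 \<noteq> (p o2)$2"
  shows "inj_on (rig p) (normalized o1 o2)"
proof (rule inj_onI)
  fix v w assume vw: "v \<in> normalized o1 o2" "w \<in> normalized o1 o2" "rig p v = rig p w"
  have "rig p (v - w) = 0" using vw(3) by (simp add: linear_diff[OF linear_rig])
  then have "rig p (v - w) $ x = 0" for x by simp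
  moreover have "v - w \<in> normalized o1 o2" using vw by (simp add: normalized_def)
  ultimately have "v - w = 0" using rig_zero_on_triangles[OF assms] by blast
  then show "v = w" by simp
qed

text \<open>The equation on \<open>o1\<close>, \<open>o2\<close>, \<open>k\<close>, \<open>l\<close>
  retains only the term of the pair \<open>k\<close>, \<open>l\<close>, with a nonzero coefficient.
  Hence the entries at \<open>o1\<close> and \<open>o2\<close> determine an element of the
  space.\<close>

lemma motion_space_zero_on_triangles:
  assumes gp: "general_position p" and o: "o1 \<noteq> o2"
    and r: "r \<in> motion_space p" "\<And>k. r $ (k, o1) = 0" "\<And>k. r $ (k, o2) = 0"
  shows "r = 0"
proof -
  have sym: "r$(i,j) = r$(j,i)" for i j using r(1) unfolding motion_space_def by blast
  have "r$(k,l) = 0" for k l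
  proof (cases "distinct [o1, o2, k, l]")
    case True
    have "quad_sum p r o1 o2 k l = 0" using r(1) True unfolding motion_space_def by blast
    moreover have "det3 (p k) (p l) (p o1) \<noteq> 0" "det3 (p k) (p l) (p o2) \<noteq> 0"
      using general_position_det3[OF gp] True by auto
    ultimately show ?thesis using r(2,3) sym[of o1] sym[of o2]
      by (simp add: quad_sum_def wterm_def)
  next
    case False
    moreover have "r$(k,k) = 0" using r(1) unfolding motion_space_def by blast
    ultimately show ?thesis using o r(2,3) sym[of k l] by auto
  qed
  then show ?thesis by (simp add: vec_eq_iff)
qed

text \<open>A motion is built point by point to match \<open>r\<close> on the edges at
  \<open>o1\<close> and \<open>o2\<close>, two linear equations per further point; the other entries
  agree by \<open>motion_space_zero_on_triangles\<close>.\<close>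

lemma rig_surj_normalized:
  assumes gp: "general_position p" and o: "o1 \<noteq> o2" "(p o1)$2 \<noteq> (p o2)$2"
    and r: "r \<in> motion_space p"
  shows "\<exists>v\<in>normalized o1 o2. rig p v = r"
proof -
  define v2 :: "real^2" where "v2 = (\<chi> m. if m = 1 then 0 else r$(o2,o1) / ((p o2)$2 - (p o1)$2))"
  have v2: "(p o2 - p o1) \<bullet> v2 = r$(o2,o1)" using o by (simp add: v2_def inner_vec_def sum_2)
  have "\<exists>w. (p k - p o1) \<bullet> w = r$(k,o1) \<and> (p k - p o2) \<bullet> w = r$(k,o2) + (p k - p o2) \<bullet> v2"
    if "k \<noteq> o1" "k \<noteq> o2" for k
    using independent_inner_solve[OF cross2_general_position[OF gp, of o1 o2 k]] that o by auto
  then obtain w where w: "\<And>k. k \<noteq> o1 \<Longrightarrow> k \<noteq> o2 \<Longrightarrow> (p k - p o1) \<bullet> w k = r$(k,o1) \<and> (p k - p o2) \<bullet> w k = r$(k,o2) + (p k - p o2) \<bullet> v2"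
    by metis
  define v :: "real^2^'a" where "v = (\<chi> k. if k = o1 then 0 else if k = o2 then v2 else w k)"
  have v: "v$o1 = 0" "v$o2 = v2" "\<And>k. k \<noteq> o1 \<Longrightarrow> k \<noteq> o2 \<Longrightarrow> v$k = w k" using o by (auto simp: v_def)
  have sym: "r$(i,j) = r$(j,i)" and diag: "r$(i,i) = 0" for i j using r unfolding motion_space_def by blast+
  have "r - rig p v = 0"
  proof (rule motion_space_zero_on_triangles[OF gp o(1)])
    show "r - rig p v \<in> motion_space p"
      by (rule subspace_diff[OF subspace_motion_space r rig_in_motion_space[OF gp]])
    show "(r - rig p v) $ (k, o1) = 0" for k
      using v2 w[of k] v diag by (cases "k = o1"; cases "k = o2") auto
    show "(r - rig p v) $ (k, o2) = 0" for k
      using v2 w[of k] v diag sym[of o1 o2]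
      by (cases "k = o1"; cases "k = o2") (auto simp: inner_diff_right inner_diff_left)
  qed
  moreover have "v \<in> normalized o1 o2" using v by (auto simp: normalized_def v2_def)
  ultimately show ?thesis by (metis eq_iff_diff_eq_0)
qed

lemma Xbar_eq: "Xbar f p o1 o2 = {v \<in> normalized o1 o2. \<forall>i j. i \<noteq> j \<longrightarrow> dmap f p v $ (i, j) \<le> 0}"
  by (auto simp: Xbar_def normalized_def dmap_def)

lemma Xf_eq: "Xf f p o1 o2 = {v \<in> Xbar f p o1 o2. \<forall>i j. hull_edge p i j \<longrightarrow> dmap f p v $ (i, j) = 0}"
  by (auto simp: Xf_def dmap_def)

lemma bij_betw_dmap:
  assumes gp: "general_position p" and o: "o1 \<noteq> o2" "(p o1)$2 \<noteq> (p o2)$2"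
  shows "bij_betw (dmap (fval a b p) p) (normalized o1 o2) (Yspace p)"
proof (rule bij_betw_imageI)
  show "inj_on (dmap (fval a b p) p) (normalized o1 o2)"
    using inj_on_rig_normalized[OF assms] by (auto simp: inj_on_def dmap_eq)
  show "dmap (fval a b p) p ` normalized o1 o2 = Yspace p"
  proof (intro equalityI subsetI)
    fix d assume d: "d \<in> Yspace p"
    have "(\<chi> ij. fval a b p (fst ij) (snd ij)) - d \<in> motion_space p"
      by (rule Yspace_diff[OF fval_in_Yspace[OF gp] d])
    then obtain v where "v \<in> normalized o1 o2" "rig p v = (\<chi> ij. fval a b p (fst ij) (snd ij)) - d"
      using rig_surj_normalized[OF assms] by blast
    then show "d \<in> dmap (fval a b p) p ` normalized o1 o2"
      by (auto simp: dmap_eq intro!: image_eqI[of _ _ v])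
  qed (auto simp: dmap_in_Yspace[OF gp])
qed

lemma bij_betw_dmap_Xbar:
  assumes "general_position p" "o1 \<noteq> o2" "(p o1)$2 \<noteq> (p o2)$2"
  shows "bij_betw (dmap (fval a b p) p) (Xbar (fval a b p) p o1 o2) (Yset p)"
proof -
  let ?g = "dmap (fval a b p) p"
  have "bij_betw ?g {v \<in> normalized o1 o2. \<forall>i j. i \<noteq> j \<longrightarrow> ?g v $ (i, j) \<le> 0} {d \<in> Yspace p. \<forall>i j. i \<noteq> j \<longrightarrow> d$(i,j) \<le> 0}"
    using bij_betw_dmap[OF assms, of a b] unfolding bij_betw_def by (auto simp: inj_on_def)
  then show ?thesis unfolding Xbar_eq Yset_eq .
qed

lemma bij_betw_dmap_Xf:
  assumes "general_position p" "o1 \<noteq> o2" "(p o1)$2 \<noteq> (p o2)$2"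
  shows "bij_betw (dmap (fval a b p) p) (Xf (fval a b p) p o1 o2)
    (Yset p \<inter> {d. \<forall>i j. hull_edge p i j \<longrightarrow> d$(i,j) = 0})"
proof -
  let ?g = "dmap (fval a b p) p"
  show ?thesis unfolding Xf_eq
    using bij_betw_dmap_Xbar[OF assms, of a b] unfolding bij_betw_def by (auto simp: inj_on_def)
qed


section \<open>Tight edges\<close>

text \<open>A row of the rigidity matrix.\<close>

definition edge_vec :: "('n::finite \<Rightarrow> real^2) \<Rightarrow> 'n \<Rightarrow> 'n \<Rightarrow> real^2^'n" where
  "edge_vec p i j = (\<chi> m. (if m = i then p i - p j else 0) - (if m = j then p i - p j else 0))"

lemma edge_vec_inner: "edge_vec p i j \<bullet> v = rig p v $ (i, j)"
proof -
  have "edge_vec p i j \<bullet> v = (\<Sum>m\<in>UNIV. (if m = i then (p i - p j) \<bullet> v$m else 0) - (if m = j then (p i - p j) \<bullet> v$m else 0))"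
    unfolding inner_vec_def[of "edge_vec p i j"]
    by (intro sum.cong refl) (auto simp: edge_vec_def inner_diff_left)
  also have "\<dots> = (p i - p j) \<bullet> v$i - (p i - p j) \<bullet> v$j"
    by (simp add: sum_subtractf)
  finally show ?thesis by (simp add: inner_diff_right)
qed

lemma edge_vec_load:
  assumes "i \<noteq> j"
  shows "edge_vec p i j $ m = (\<Sum>l\<in>UNIV. of_bool ({m, l} = {i, j}) *\<^sub>R (p m - p l))"
proof -
  have "(\<Sum>l\<in>UNIV. of_bool ({m, l} = {i, j}) *\<^sub>R (p m - p l)) =
    (\<Sum>l\<in>UNIV. (if l = j then (if m = i then p i - p j else 0) else 0) + (if l = i then (if m = j then p j - p i else 0) else 0))"
    using assms by (intro sum.cong refl) (auto simp: doubleton_eq_iff)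
  also have "\<dots> = edge_vec p i j $ m"
    by (simp add: sum.distrib edge_vec_def)
  finally show ?thesis by simp
qed

text \<open>Absence of self-stresses says that the row of the edge is not in the span of the other
  rows; its component orthogonal to that span, rescaled, is the motion.\<close>

lemma pointed_noncrossing_dual:
  assumes gp: "general_position p" and pn: "pointed_noncrossing p E" and ij: "E i j"
  shows "\<exists>v. rig p v $ (i, j) = 1 \<and> (\<forall>k l. E k l \<and> {k, l} \<noteq> {i, j} \<longrightarrow> rig p v $ (k, l) = 0)"
proof -
  define B where "B = {edge_vec p k l | k l. E k l \<and> {k, l} \<noteq> {i, j}}"
  \<comment> \<open>Loads resolved by symmetric weights on the remaining edges. The set is a
    subspace containing the rows, so membership in the span yields symmetric weights.\<close>
  let ?Q = "{x. \<exists>\<omega>. (\<forall>k l. \<omega> k l = \<omega> l k) \<and> (\<forall>k l. \<omega> k l \<noteq> 0 \<longrightarrow> E k l \<and> {k, l} \<noteq> {i, j})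
     \<and> (\<forall>m. x$m = (\<Sum>l\<in>UNIV. \<omega> m l *\<^sub>R (p m - p l)))}"
  have "subspace ?Q"
  proof (rule subspaceI)
    show "0 \<in> ?Q" by (auto intro: exI[of _ "\<lambda>_ _. 0"])
  next
    fix x y assume "x \<in> ?Q" "y \<in> ?Q"
    then obtain \<omega> \<omega>' where 
      o: "\<And>k l. \<omega> k l = \<omega> l k" "\<And>k l. \<omega> k l \<noteq> 0 \<Longrightarrow> E k l \<and> {k, l} \<noteq> {i, j}"
        "\<And>m. x$m = (\<Sum>l\<in>UNIV. \<omega> m l *\<^sub>R (p m - p l))" and
      o': "\<And>k l. \<omega>' k l = \<omega>' l k" "\<And>k l. \<omega>' k l \<noteq> 0 \<Longrightarrow> E k l \<and> {k, l} \<noteq> {i, j}"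
        "\<And>m. y$m = (\<Sum>l\<in>UNIV. \<omega>' m l *\<^sub>R (p m - p l))" by auto
    show "x + y \<in> ?Q"
    proof (intro CollectI exI[of _ "\<lambda>k l. \<omega> k l + \<omega>' k l"] conjI allI)
      fix k l show "\<omega> k l + \<omega>' k l \<noteq> 0 \<longrightarrow> E k l \<and> {k, l} \<noteq> {i, j}"
        using o(2)[of k l] o'(2)[of k l] by fastforce
      show "\<omega> k l + \<omega>' k l = \<omega> l k + \<omega>' l k" using o(1)[of k l] o'(1)[of k l] by simp
    qed (simp add: o(3) o'(3) scaleR_add_left sum.distrib)
  next
    fix c x assume "x \<in> ?Q"
    then obtain \<omega> where
      o: "\<And>k l. \<omega> k l = \<omega> l k" "\<And>k l. \<omega> k l \<noteq> 0 \<Longrightarrow> E k l \<and> {k, l} \<noteq> {i, j}"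
        "\<And>m. x$m = (\<Sum>l\<in>UNIV. \<omega> m l *\<^sub>R (p m - p l))" by auto
    show "c *\<^sub>R x \<in> ?Q"
    proof (intro CollectI exI[of _ "\<lambda>k l. c * \<omega> k l"] conjI allI)
      fix k l show "c * \<omega> k l \<noteq> 0 \<longrightarrow> E k l \<and> {k, l} \<noteq> {i, j}"
        using o(2)[of k l] by fastforce
      show "c * \<omega> k l = c * \<omega> l k" using o(1)[of k l] by simp
    qed (simp add: o(3) scaleR_sum_right)
  qed
  moreover have "B \<subseteq> ?Q"
  proof
    fix x assume "x \<in> B"
    then obtain k l where kl: "x = edge_vec p k l" "E k l" "{k, l} \<noteq> {i, j}" by (auto simp: B_def)
    have "k \<noteq> l" "E l k" using pointed_noncrossing_edge[OF pn kl(2)] by auto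
    show "x \<in> ?Q"
    proof (intro CollectI exI[of _ "\<lambda>a b. of_bool ({a, b} = {k, l})"] conjI allI)
      fix m show "x$m = (\<Sum>b\<in>UNIV. of_bool ({m, b} = {k, l}) *\<^sub>R (p m - p b))"
        unfolding kl(1) using edge_vec_load[OF \<open>k \<noteq> l\<close>] .
      fix b show "(of_bool ({m, b} = {k, l}) :: real) = of_bool ({b, m} = {k, l})" by (simp add: insert_commute)
      show "of_bool ({m, b} = {k, l}) \<noteq> (0::real) \<longrightarrow> E m b \<and> {m, b} \<noteq> {i, j}"
        using kl \<open>E l k\<close> by (auto simp: doubleton_eq_iff)
    qed
  qed
  ultimately have spanQ: "span B \<subseteq> ?Q" by (rule span_minimal[rotated])
  have ine: "i \<noteq> j" using pointed_noncrossing_edge[OF pn ij] by simp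
  have notin: "edge_vec p i j \<notin> span B"
  proof
    assume "edge_vec p i j \<in> span B"
    then have "edge_vec p i j \<in> ?Q" using spanQ by blast
    then obtain \<omega> where
      o: "\<And>k l. \<omega> k l = \<omega> l k" "\<And>k l. \<omega> k l \<noteq> 0 \<Longrightarrow> E k l \<and> {k, l} \<noteq> {i, j}"
        "\<And>m. edge_vec p i j$m = (\<Sum>l\<in>UNIV. \<omega> m l *\<^sub>R (p m - p l))" by auto
    \<comment> \<open>Moving the row of \<open>i\<close>, \<open>j\<close> to the other side gives a
      self-stress with value -1 on that edge.\<close>
    let ?w = "\<lambda>k l. \<omega> k l - of_bool ({k, l} = {i, j})"
    have "?w i j = 0"
    proof (rule pointed_noncrossing_stress_free[where \<omega> = ?w, OF gp _ pn])
      have "(\<Sum>l\<in>UNIV. ?w m l *\<^sub>R (p l - p m)) = 0" for m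
      proof -
        have "(\<Sum>l\<in>UNIV. ?w m l *\<^sub>R (p l - p m)) =
          (\<Sum>l\<in>UNIV. of_bool ({m, l} = {i, j}) *\<^sub>R (p m - p l)) - (\<Sum>l\<in>UNIV. \<omega> m l *\<^sub>R (p m - p l))"
          by (simp add: sum_subtractf[symmetric] algebra_simps)
        then show ?thesis using o(3)[of m] edge_vec_load[OF ine, of p m] by simp
      qed
      then show "stress p ?w" unfolding stress_def using o(1) by (auto simp: insert_commute)
      show "?w k l \<noteq> 0 \<Longrightarrow> E k l" for k l
        using o(2)[of k l] ij pointed_noncrossing_edge[OF pn ij]
        by (cases "{k, l} = {i, j}") (auto simp: doubleton_eq_iff)
    qed
    then show False using o(2)[of i j] by auto
  qed
  obtain y z where yz: "y \<in> span B" "\<And>w. w \<in> span B \<Longrightarrow> orthogonal z w" "edge_vec p i j = y + z"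
    using orthogonal_subspace_decomp_exists by metis
  have "z \<noteq> 0" using yz notin by auto
  define v where "v = (1 / (z \<bullet> z)) *\<^sub>R z"
  have "z \<bullet> y = 0" using yz(1,2) by (simp add: orthogonal_def)
  then have "edge_vec p i j \<bullet> v = 1" using \<open>z \<noteq> 0\<close>
    by (simp add: yz(3) v_def inner_add_left inner_commute[of y])
  moreover have "edge_vec p k l \<bullet> v = 0" if "E k l" "{k, l} \<noteq> {i, j}" for k l
  proof -
    have "edge_vec p k l \<in> span B" using that by (auto simp: B_def intro!: span_base)
    then show ?thesis using yz(2) by (simp add: v_def orthogonal_def inner_commute[of "edge_vec p k l"])
  qed
  ultimately show ?thesis unfolding edge_vec_inner by blast
qed

section \<open>Signs in the equations on four points\<close>

definition tight :: "real^('n \<times> 'n::finite) \<Rightarrow> 'n \<Rightarrow> 'n \<Rightarrow> bool" where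
  "tight d i j \<longleftrightarrow> i \<noteq> j \<and> d$(i,j) = 0"

lemma Yset_quad:
  assumes "d \<in> Yset p" "general_position p" "distinct [i, j, k, l]"
  obtains a b c e where "a = det3 (p j) (p k) (p l)" "b = - det3 (p i) (p k) (p l)"
    "c = det3 (p i) (p j) (p l)" "e = - det3 (p i) (p j) (p k)" "a + b + c + e = 0" "a*b*c*e \<noteq> 0"
    "a*b*d$(i,j) + a*c*d$(i,k) + a*e*d$(i,l) + b*c*d$(j,k) + b*e*d$(j,l) + c*e*d$(k,l) = - (a*b*c*e)"
    "d$(i,j) \<le> 0" "d$(i,k) \<le> 0" "d$(i,l) \<le> 0" "d$(j,k) \<le> 0" "d$(j,l) \<le> 0" "d$(k,l) \<le> 0"
proof -
  have q: "quad_sum p d i j k l = 1" using assms by (simp add: Yset_def)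
  define a b c e where abce: "a = det3 (p j) (p k) (p l)" "b = - det3 (p i) (p k) (p l)"
    "c = det3 (p i) (p j) (p l)" "e = - det3 (p i) (p j) (p k)"
  have nz: "a*b*c*e \<noteq> 0" using quad_sum_eq(2)[OF assms(2,3)] by (simp add: abce)
  have "a + b + c + e = 0" unfolding abce by (rule affine_dependence(1))
  moreover have "a*b*d$(i,j) + a*c*d$(i,k) + a*e*d$(i,l) + b*c*d$(j,k) + b*e*d$(j,l) + c*e*d$(k,l) = - (a*b*c*e)"
    (is "?s = _")
  proof -
    have "- ?s / (a*b*c*e) = 1"
      using q unfolding quad_sum_eq(1)[OF assms(2,3)] abce .
    then show ?thesis using nz by (simp only: divide_eq_1_iff) linarith
  qed
  moreover have "x \<noteq> y \<Longrightarrow> d$(x,y) \<le> 0" for x y using assms(1) by (simp add: Yset_def)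
  ultimately show ?thesis using that[OF abce] nz assms(3) by simp
qed

text \<open>At a crossing \<open>a\<close>, \<open>b\<close> have one sign and \<open>c\<close>,
  \<open>e\<close> the other. Tightness removes the two products of equal signs, so the left side of
  the equation is nonnegative while the right side, \<open>- (a*b*c*e)\<close>, is negative.\<close>

lemma tight_noncrossing:
  assumes d: "d \<in> Yset p" and gp: "general_position p" and ijkl: "distinct [i, j, k, l]"
    and t: "tight d i j" "tight d k l"
  shows "\<not> (det3 (p i) (p j) (p k) * det3 (p i) (p j) (p l) < 0 \<and>
             det3 (p k) (p l) (p i) * det3 (p k) (p l) (p j) < 0)"
proof
  assume cr: "det3 (p i) (p j) (p k) * det3 (p i) (p j) (p l) < 0 \<and>
             det3 (p k) (p l) (p i) * det3 (p k) (p l) (p j) < 0"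
  obtain a b c e where q: "a = det3 (p j) (p k) (p l)" "b = - det3 (p i) (p k) (p l)"
    "c = det3 (p i) (p j) (p l)" "e = - det3 (p i) (p j) (p k)" "a + b + c + e = 0" "a*b*c*e \<noteq> 0"
    "a*b*d$(i,j) + a*c*d$(i,k) + a*e*d$(i,l) + b*c*d$(j,k) + b*e*d$(j,l) + c*e*d$(k,l) = - (a*b*c*e)"
    "d$(i,j) \<le> 0" "d$(i,k) \<le> 0" "d$(i,l) \<le> 0" "d$(j,k) \<le> 0" "d$(j,l) \<le> 0" "d$(k,l) \<le> 0"
    using Yset_quad[OF d gp ijkl] by blast
  have ce: "c * e > 0" using cr by (simp add: q(3,4) mult.commute)
  have "det3 (p k) (p l) (p i) * det3 (p k) (p l) (p j) = - (a * b)"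
    by (simp add: q(1,2) det3_def algebra_simps)
  then have ab: "a * b > 0" using cr by simp
  have s: "a * c \<le> 0 \<and> a * e \<le> 0 \<and> b * c \<le> 0 \<and> b * e \<le> 0"
    using ab ce q(5) by (auto simp: zero_less_mult_iff mult_le_0_iff)
  have "a*c*d$(i,k) \<ge> 0" "a*e*d$(i,l) \<ge> 0" "b*c*d$(j,k) \<ge> 0" "b*e*d$(j,l) \<ge> 0"
    using s q(8-) by (auto intro!: mult_nonpos_nonpos)
  moreover have "a*b*c*e > 0" using mult_pos_pos[OF ab ce] by (simp add: mult_ac)
  ultimately show False using q(7) t by (simp add: tight_def)
qed

text \<open>A positive dependence puts \<open>p i\<close> inside the triangle of the others:
  \<open>b\<close>, \<open>c\<close>, \<open>e\<close> share a sign opposite to that of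
  \<open>a\<close>. Tightness removes the terms with \<open>a\<close>, leaving a nonpositive left
  side and a positive right side.\<close>

lemma tight_pointed_triple:
  assumes d: "d \<in> Yset p" and gp: "general_position p" and ijkl: "distinct [i, j, k, l]"
    and t: "tight d i j" "tight d i k" "tight d i l" and pos: "\<alpha> > 0" "\<beta> > 0" "\<gamma> > 0"
  shows "\<alpha> *\<^sub>R (p j - p i) + \<beta> *\<^sub>R (p k - p i) + \<gamma> *\<^sub>R (p l - p i) \<noteq> 0"
proof
  assume z: "\<alpha> *\<^sub>R (p j - p i) + \<beta> *\<^sub>R (p k - p i) + \<gamma> *\<^sub>R (p l - p i) = 0"
  obtain a b c e where q: "a = det3 (p j) (p k) (p l)" "b = - det3 (p i) (p k) (p l)"
    "c = det3 (p i) (p j) (p l)" "e = - det3 (p i) (p j) (p k)" "a + b + c + e = 0" "a*b*c*e \<noteq> 0"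
    "a*b*d$(i,j) + a*c*d$(i,k) + a*e*d$(i,l) + b*c*d$(j,k) + b*e*d$(j,l) + c*e*d$(k,l) = - (a*b*c*e)"
    "d$(i,j) \<le> 0" "d$(i,k) \<le> 0" "d$(i,l) \<le> 0" "d$(j,k) \<le> 0" "d$(j,l) \<le> 0" "d$(k,l) \<le> 0"
    using Yset_quad[OF d gp ijkl] by blast
  have "cross2 (p j - p i) (\<alpha> *\<^sub>R (p j - p i) + \<beta> *\<^sub>R (p k - p i) + \<gamma> *\<^sub>R (p l - p i)) = 0"
    "cross2 (p k - p i) (\<alpha> *\<^sub>R (p j - p i) + \<beta> *\<^sub>R (p k - p i) + \<gamma> *\<^sub>R (p l - p i)) = 0" using z by simp_all
  then have 1: "\<gamma> * c = \<beta> * e" "\<gamma> * b = \<alpha> * e"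
    by (auto simp: q(2-4) cross2_def det3_def algebra_simps)
  have "sgn c = sgn e" "sgn b = sgn e"
    using arg_cong[OF 1(1), of sgn] arg_cong[OF 1(2), of sgn] pos by (simp_all add: sgn_mult)
  then have s: "b * c > 0 \<and> b * e > 0 \<and> c * e > 0 \<and> a * e < 0"
    using q(5,6) by (auto simp: sgn_if zero_less_mult_iff mult_less_0_iff split: if_splits)
  have "b*c*d$(j,k) \<le> 0" "b*e*d$(j,l) \<le> 0" "c*e*d$(k,l) \<le> 0"
    using s q(8-) by (auto intro!: mult_nonneg_nonpos)
  moreover have "a*b*c*e < 0" using mult_neg_pos[of "a*e" "b*c"] s by (simp add: mult_ac)
  ultimately show False using q(7) t by (simp add: tight_def)
qed

text \<open>Caratheodory's theorem in the plane with zero weights discarded. The first two cases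
  contradict general position, the third contradicts \<open>tight_pointed_triple\<close>.\<close>

lemma finite_hull_zero_cases:
  fixes V :: "(real^2) set"
  assumes "0 \<in> convex hull V"
  obtains x where "x \<in> V" "x = 0"
  | x y where "x \<in> V" "y \<in> V" "x \<noteq> y" "cross2 x y = 0"
  | x y z \<alpha> \<beta> \<gamma> where "x \<in> V" "y \<in> V" "z \<in> V" "distinct [x, y, z]" "\<alpha> > 0" "\<beta> > 0" "\<gamma> > 0"
      "\<alpha> *\<^sub>R x + \<beta> *\<^sub>R y + \<gamma> *\<^sub>R z = 0"
proof -
  have "\<exists>S u. finite S \<and> S \<subseteq> V \<and> card S \<le> DIM(real^2) + 1 \<and> (\<forall>x\<in>S. 0 \<le> u x) \<and> sum u S = 1 \<and> (\<Sum>v\<in>S. u v *\<^sub>R v) = 0"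
    by (rule assms[unfolded convex_hull_caratheodory mem_Collect_eq])
  then obtain S u where S: "finite S" "S \<subseteq> V" "card S \<le> DIM(real^2) + 1" "\<And>x. x \<in> S \<Longrightarrow> 0 \<le> u x"
    "sum u S = 1" "(\<Sum>v\<in>S. u v *\<^sub>R v) = 0" by (elim exE conjE) (rule that, auto)
  have S3: "card S \<le> 3" using S(3) by simp
  define S' where "S' = {x \<in> S. u x \<noteq> 0}"
  have S': "finite S'" "S' \<subseteq> V" "card S' \<le> 3" "\<And>x. x \<in> S' \<Longrightarrow> 0 < u x"
    using S(1,2,4) S3 card_mono[of S S'] by (auto simp: S'_def less_le)
  have "sum u S' = 1" unfolding S(5)[symmetric] S'_def using S(1) by (intro sum.mono_neutral_left) auto
  then have ne: "S' \<noteq> {}" by auto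
  have z: "(\<Sum>v\<in>S'. u v *\<^sub>R v) = 0" unfolding S(6)[symmetric] S'_def using S(1) by (intro sum.mono_neutral_left) auto
  have "card S' = 1 \<or> card S' = 2 \<or> card S' = 3" using S'(1,3) ne card_gt_0_iff[of S'] by linarith
  then show ?thesis
  proof (elim disjE)
    assume "card S' = 1"
    then obtain x where "S' = {x}" using card_1_singletonE by blast
    then show ?thesis using z S'(2,4) that(1)[of x] by auto
  next
    assume "card S' = 2"
    then obtain x y where xy: "S' = {x, y}" "x \<noteq> y" using card_2_iff by metis
    then have "u x *\<^sub>R x + u y *\<^sub>R y = 0" using z by simp
    then have "cross2 x (u x *\<^sub>R x + u y *\<^sub>R y) = 0" by simp
    then have "cross2 x y = 0" using S'(4)[of y] xy by (simp add: cross2_add_right cross2_scale_right)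
    then show ?thesis using that(2)[of x y] xy S' by auto
  next
    assume "card S' = 3"
    then obtain x y w where xy: "S' = {x, y, w}" "x \<noteq> y" "x \<noteq> w" "y \<noteq> w" using card_3_iff by metis
    then show ?thesis using that(3)[of x y w "u x" "u y" "u w"] z S'(2,4) by (auto simp: add.assoc)
  qed
qed

text \<open>The edge directions do not have 0 in their convex hull, so a line separates 0 from it;
  \<open>u\<close> is its normal turned by a right angle.\<close>

lemma tight_pointed:
  assumes d: "d \<in> Yset p" and gp: "general_position p"
  shows "\<exists>u. u \<noteq> 0 \<and> (\<forall>j. tight d i j \<longrightarrow> cross2 u (p j - p i) \<ge> 0)"
proof -
  define V where "V = (\<lambda>j. p j - p i) ` {j. tight d i j}"
  have "0 \<notin> convex hull V"
  proof
    assume "0 \<in> convex hull V"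
    then show False
    proof (cases rule: finite_hull_zero_cases)
      case (1 x)
      then show False using gp by (auto simp: V_def tight_def general_position_def dest: injD)
    next
      case (2 x y)
      then obtain j k where jk: "x = p j - p i" "y = p k - p i" "tight d i j" "tight d i k" by (auto simp: V_def)
      then have "det3 (p i) (p j) (p k) = 0" "j \<noteq> k" using 2 by (auto simp: det3_cross2)
      then show False using general_position_det3[OF gp, of i j k] jk by (auto simp: tight_def)
    next
      case (3 x y z \<alpha> \<beta> \<gamma>)
      then obtain j k l where jk: "x = p j - p i" "y = p k - p i" "z = p l - p i"
        "tight d i j" "tight d i k" "tight d i l" by (auto simp: V_def)
      then have "distinct [i, j, k, l]" using 3(4) by (auto simp: tight_def)
      then show False using tight_pointed_triple[OF d gp _ jk(4-6) 3(5-7)] 3(8) jk by simp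
    qed
  qed
  then obtain a where a: "a \<noteq> 0" "\<And>x. x \<in> convex hull V \<Longrightarrow> 0 \<le> a \<bullet> x"
    using separating_hyperplane_set_0[OF convex_convex_hull] by blast
  define u :: "real^2" where "u = (\<chi> m. if m = 1 then a$2 else - a$1)"
  have "u \<noteq> 0" using a(1) by (auto simp: u_def vec_eq_iff forall_2)
  moreover have "cross2 u x = a \<bullet> x" for x
    by (simp add: u_def cross2_def inner_vec_def sum_2)
  moreover have "p j - p i \<in> convex hull V" if "tight d i j" for j
    using that by (auto simp: V_def intro!: hull_inc)
  ultimately show ?thesis using a(2) by (intro exI[of _ u]) auto
qed

lemma tight_pointed_noncrossing:
  assumes d: "d \<in> Yset p" and gp: "general_position p"
  shows "pointed_noncrossing p (tight d)"
proof -
  have "tight d i j \<Longrightarrow> tight d j i \<and> i \<noteq> j" for i j using d by (auto simp: tight_def Yset_def)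
  then show ?thesis unfolding pointed_noncrossing_def
    using tight_noncrossing[OF assms] tight_pointed[OF assms] by blast
qed

text \<open>No edge crosses a segment with all points on one side. At its ends the segment's own
  direction, oriented by \<open>s\<close>, bounds a half-plane containing everything; at other
  vertices the edges are unchanged.\<close>

lemma pointed_noncrossing_insert_extremal:
  assumes gp: "general_position p" and pn: "pointed_noncrossing p E" and ij: "i \<noteq> j"
    and side: "s \<noteq> 0" "\<And>k. s * det3 (p i) (p j) (p k) \<ge> 0"
  shows "pointed_noncrossing p (\<lambda>k l. E k l \<or> {k, l} = {i, j})" (is "pointed_noncrossing p ?E")
  unfolding pointed_noncrossing_def
proof (intro conjI allI impI)
  fix k l assume kl: "?E k l"
  then show "?E l k" "k \<noteq> l" using pointed_noncrossing_edge[OF pn, of k l] ij by (auto simp: doubleton_eq_iff)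
next
  have side2: "\<not> det3 (p a) (p b) (p k) * det3 (p a) (p b) (p l) < 0" if "{a, b} = {i, j}" for a b k l
  proof -
    have "(s * det3 (p i) (p j) (p k)) * (s * det3 (p i) (p j) (p l)) \<ge> 0"
      by (intro mult_nonneg_nonneg side)
    then have "s\<^sup>2 * (det3 (p i) (p j) (p k) * det3 (p i) (p j) (p l)) \<ge> 0" by (simp add: power2_eq_square mult_ac)
    then have "det3 (p i) (p j) (p k) * det3 (p i) (p j) (p l) \<ge> 0" using side(1) by (simp add: zero_le_mult_iff)
    moreover have "det3 (p a) (p b) (p k) * det3 (p a) (p b) (p l) = det3 (p i) (p j) (p k) * det3 (p i) (p j) (p l)"
      using that det3_swap[of "p k" "p i" "p j"] det3_swap[of "p l" "p i" "p j"]
        det3_cyclic[of "p i" "p j" "p k"] det3_cyclic[of "p i" "p j" "p l"]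
        det3_cyclic[of "p j" "p i" "p k"] det3_cyclic[of "p j" "p i" "p l"]
      by (auto simp: doubleton_eq_iff)
    ultimately show ?thesis by simp
  qed
  fix a b k l assume abkl: "?E a b \<and> ?E k l \<and> distinct [a, b, k, l]"
  show "\<not> (det3 (p a) (p b) (p k) * det3 (p a) (p b) (p l) < 0 \<and>
             det3 (p k) (p l) (p a) * det3 (p k) (p l) (p b) < 0)"
  proof (cases "{a, b} = {i, j} \<or> {k, l} = {i, j}")
    case True
    then show ?thesis using side2[of a b k l] side2[of k l a b] by blast
  next
    case False
    then have "E a b \<and> E k l \<and> distinct [a, b, k, l]" using abkl by blast
    then show ?thesis using pn unfolding pointed_noncrossing_def by blast
  qed
next
  fix m
  have e: "p i \<noteq> p j" using gp ij by (auto simp: general_position_def dest: injD)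
  show "\<exists>u. u \<noteq> 0 \<and> (\<forall>l. ?E m l \<longrightarrow> cross2 u (p l - p m) \<ge> 0)"
  proof (cases "m = i \<or> m = j")
    case True
    have "cross2 (s *\<^sub>R (p j - p i)) (p l - p m) = s * det3 (p i) (p j) (p l)" for l
      using True by (auto simp: cross2_def det3_def algebra_simps)
    then show ?thesis using side e by (intro exI[of _ "s *\<^sub>R (p j - p i)"]) auto
  next
    case False
    then have "?E m l \<longleftrightarrow> E m l" for l by (auto simp: doubleton_eq_iff)
    then show ?thesis using pn unfolding pointed_noncrossing_def by simp
  qed
qed


section \<open>Facets at an extreme point\<close>

lemma small_step:
  fixes c :: "'i \<Rightarrow> 'a::euclidean_space"
  assumes "finite J" "\<And>e. e \<in> J \<Longrightarrow> c e \<bullet> x < b e"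
  shows "\<exists>t>0. \<forall>e\<in>J. c e \<bullet> (x + t *\<^sub>R v) < b e \<and> c e \<bullet> (x - t *\<^sub>R v) < b e"
proof -
  have "\<forall>\<^sub>F t in at_right (0::real). \<forall>e\<in>J. c e \<bullet> (x + t *\<^sub>R v) < b e \<and> c e \<bullet> (x - t *\<^sub>R v) < b e"
  proof (intro eventually_ball_finite assms(1) ballI eventually_conj)
    fix e assume "e \<in> J"
    have "((\<lambda>t. c e \<bullet> (x + t *\<^sub>R v)) \<longlongrightarrow> c e \<bullet> (x + 0 *\<^sub>R v)) (at_right 0)"
      "((\<lambda>t. c e \<bullet> (x - t *\<^sub>R v)) \<longlongrightarrow> c e \<bullet> (x - 0 *\<^sub>R v)) (at_right 0)"
      by (intro tendsto_intros)+
    then show "\<forall>\<^sub>F t in at_right 0. c e \<bullet> (x + t *\<^sub>R v) < b e" "\<forall>\<^sub>F t in at_right 0. c e \<bullet> (x - t *\<^sub>R v) < b e"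
      using assms(2)[OF \<open>e \<in> J\<close>] by (auto dest: order_tendstoD(2))
  qed
  then have "\<forall>\<^sub>F t in at_right (0::real). t > 0 \<and> (\<forall>e\<in>J. c e \<bullet> (x + t *\<^sub>R v) < b e \<and> c e \<bullet> (x - t *\<^sub>R v) < b e)"
    using eventually_at_right_less by (rule eventually_conj[rotated])
  then show ?thesis using eventually_happens'[OF trivial_limit_at_right_real] by blast
qed

text \<open>Equations are kept in \<open>A\<close>, apart from the inequalities. The strict point
  \<open>x0\<close> makes the dimension of the polyhedron that of \<open>A\<close>.\<close>

locale affine_system =
  fixes A :: "'a::euclidean_space set" and I :: "'i set" and c :: "'i \<Rightarrow> 'a" and b :: "'i \<Rightarrow> real" and x0 :: 'a
  assumes affA: "affine A" and finI: "finite I"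
    and x0: "x0 \<in> A" "\<And>e. e \<in> I \<Longrightarrow> c e \<bullet> x0 < b e"
begin

definition S where "S = {x \<in> A. \<forall>e\<in>I. c e \<bullet> x \<le> b e}"
definition H where "H e = S \<inter> {x. c e \<bullet> x = b e}"
definition T where "T x = {e \<in> I. c e \<bullet> x = b e}"

lemma S_eq: "S = A \<inter> (\<Inter>e\<in>I. {x. c e \<bullet> x \<le> b e})"
  by (auto simp: S_def)

lemma polyhedron_S: "polyhedron S"
  unfolding S_eq using finI
  by (intro polyhedron_Int affine_imp_polyhedron[OF affA] polyhedron_Inter) (auto simp: polyhedron_halfspace_le)

lemma convex_S: "convex S" by (rule polyhedron_imp_convex[OF polyhedron_S])

lemma H_face: "e \<in> I \<Longrightarrow> H e face_of S"
  unfolding H_def by (intro face_of_Int_supporting_hyperplane_le convex_S) (auto simp: S_def)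

lemma aff_dim_between:
  assumes "affine B" "B \<subseteq> A" "finite J" "q \<in> B" "\<And>e. e \<in> J \<Longrightarrow> c e \<bullet> q < b e"
    and "{x \<in> B. \<forall>e\<in>J. c e \<bullet> x < b e} \<subseteq> C" "C \<subseteq> B"
  shows "aff_dim C = aff_dim B"
proof -
  let ?U = "{x \<in> B. \<forall>e\<in>J. c e \<bullet> x < b e}"
  have "?U = B \<inter> (\<Inter>e\<in>J. {x. c e \<bullet> x < b e})" by auto
  moreover have "open (\<Inter>e\<in>J. {x. c e \<bullet> x < b e})"
    using assms(3) by (intro open_INT ballI open_halfspace_lt)
  ultimately have "openin (top_of_set B) ?U" by (metis openin_open_Int)
  moreover have "?U \<noteq> {}" using assms(4,5) by auto
  ultimately have "aff_dim ?U = aff_dim B" using assms(1) by (intro aff_dim_openin)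
  then show ?thesis using aff_dim_subset[OF assms(6)] aff_dim_subset[OF assms(7)] by simp
qed

lemma aff_dim_S: "aff_dim S = aff_dim A"
  by (rule aff_dim_between[OF affA _ finI x0(1)]) (use x0 in \<open>auto simp: S_def less_imp_le\<close>)

text \<open>Near \<open>q\<close> only constraint \<open>e\<close> is active, so \<open>H e\<close>
  is open there in a hyperplane section of \<open>A\<close>; the section is proper because it misses
  \<open>x0\<close>.\<close>

lemma H_facet:
  assumes e: "e \<in> I" and q: "q \<in> A" "c e \<bullet> q = b e" "\<And>f. f \<in> I \<Longrightarrow> f \<noteq> e \<Longrightarrow> c f \<bullet> q < b f"
  shows "H e facet_of S"
proof -
  have qH: "q \<in> H e" using q by (auto simp: H_def S_def) (metis less_imp_le order_refl)
  let ?B = "A \<inter> {x. c e \<bullet> x = b e}"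
  have "aff_dim (H e) = aff_dim ?B"
    by (rule aff_dim_between[of ?B "I - {e}" q])
       (use affA finI q e in \<open>auto simp: H_def S_def affine_hyperplane intro!: affine_Int\<close>,
         metis insert_Diff insert_iff less_imp_le order_refl)
  also have "\<dots> = aff_dim A - 1"
  proof -
    have "\<not> A \<subseteq> {x. c e \<bullet> x = b e}" using x0(1) x0(2)[OF e] by auto
    moreover have "?B \<noteq> {}" using q by auto
    ultimately show ?thesis using aff_dim_affine_Int_hyperplane[OF affA, of "c e" "b e"] by simp
  qed
  finally show ?thesis unfolding facet_of_def using H_face[OF e] qH aff_dim_S by auto
qed

text \<open>If no constraint were active at a relative interior point \<open>q\<close> of the face,
  every segment from a point \<open>s\<close> of \<open>S\<close> to \<open>q\<close> could be
  prolonged inside \<open>S\<close>, and the face would contain every \<open>s\<close>.\<close>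

lemma proper_face_subset:
  assumes C: "C face_of S" "C \<noteq> {}" "C \<noteq> S"
  shows "\<exists>e\<in>I. C \<subseteq> H e"
proof -
  have cvC: "convex C" using C face_of_imp_convex by blast
  have CS: "C \<subseteq> S" using C face_of_imp_subset by blast
  obtain q where q: "q \<in> rel_interior C" using cvC C(2) rel_interior_eq_empty by blast
  then have qC: "q \<in> C" using rel_interior_subset by blast
  have "\<exists>e\<in>I. c e \<bullet> q = b e"
  proof (rule ccontr)
    assume N: "\<not> ?thesis"
    have "s \<in> C" if s: "s \<in> S" for s
    proof (cases "s = q")
      case False
      have "\<And>e. e \<in> I \<Longrightarrow> c e \<bullet> q < b e" using N qC CS by (auto simp: S_def less_le)
      then obtain t where t: "t > 0" "\<And>e. e \<in> I \<Longrightarrow> c e \<bullet> (q + t *\<^sub>R (q - s)) < b e"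
        using small_step[OF finI, of c q b "q - s"] by blast
      have "(1 + t) *\<^sub>R q + (- t) *\<^sub>R s \<in> A"
        by (rule mem_affine[OF affA]) (use qC CS s in \<open>auto simp: S_def\<close>)
      then have "q + t *\<^sub>R (q - s) \<in> A" by (simp add: algebra_simps)
      then have "q + t *\<^sub>R (q - s) \<in> S" using t by (auto simp: S_def less_imp_le)
      moreover have "q \<in> open_segment s (q + t *\<^sub>R (q - s))"
        unfolding in_segment
      proof (intro conjI exI[of _ "1 / (1 + t)"])
        show "s \<noteq> q + t *\<^sub>R (q - s)"
        proof
          assume "s = q + t *\<^sub>R (q - s)"
          then have "(1 + t) *\<^sub>R (q - s) = 0" by (simp add: algebra_simps)
          then show False using t False by simp
        qed
        have "(1 + t) *\<^sub>R ((1 - 1 / (1 + t)) *\<^sub>R s + (1 / (1 + t)) *\<^sub>R (q + t *\<^sub>R (q - s))) = (1 + t) *\<^sub>R q"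
          using t by (simp add: scaleR_add_right right_diff_distrib) (simp add: algebra_simps)
        then show "q = (1 - 1 / (1 + t)) *\<^sub>R s + (1 / (1 + t)) *\<^sub>R (q + t *\<^sub>R (q - s))"
          using t by (metis add_pos_pos less_numeral_extra(3) real_vector.scale_cancel_left zero_less_one)
      qed (use t in auto)
      ultimately show ?thesis using C(1) s qC unfolding face_of_def by blast
    qed (use qC in simp)
    then show False using C(3) CS by blast
  qed
  then obtain e where e: "e \<in> I" "c e \<bullet> q = b e" by blast
  then have "q \<in> H e" using qC CS by (auto simp: H_def)
  then show ?thesis using subset_of_face_of[OF H_face[OF e(1)] CS] q e by blast
qed

lemma facet_is_H:
  assumes "C facet_of S" and all: "\<And>e. e \<in> I \<Longrightarrow> C \<subseteq> H e \<Longrightarrow> H e facet_of S"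
  shows "\<exists>e\<in>I. C = H e"
proof -
  have C: "C face_of S" "C \<noteq> {}" "aff_dim C = aff_dim S - 1" using assms(1) by (auto simp: facet_of_def)
  then obtain e where e: "e \<in> I" "C \<subseteq> H e" using proper_face_subset by fastforce
  have "C face_of H e" using face_of_subset[OF C(1) e(2)] by (auto simp: H_def)
  moreover have "convex (H e)" using H_face[OF e(1)] face_of_imp_convex by blast
  moreover have "aff_dim (H e) = aff_dim S - 1" using all[OF e] by (auto simp: facet_of_def)
  ultimately have "C = H e" using face_of_aff_dim_lt[of "H e" C] C(3) by fastforce
  then show ?thesis using e by blast
qed

text \<open>A direction that preserves the active constraints can be followed a little both ways,
  making \<open>x\<close> a midpoint.\<close>

lemma extreme_tight_zero:
  assumes x: "x extreme_point_of S" and v: "x + v \<in> A" "\<And>e. e \<in> T x \<Longrightarrow> c e \<bullet> v = 0"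
  shows "v = 0"
proof (rule ccontr)
  assume "v \<noteq> 0"
  have xS: "x \<in> S" using x by (simp add: extreme_point_of_def)
  have "\<And>e. e \<in> I - T x \<Longrightarrow> c e \<bullet> x < b e" using xS by (auto simp: S_def T_def less_le)
  then obtain t where t: "t > 0" "\<And>e. e \<in> I - T x \<Longrightarrow> c e \<bullet> (x + t *\<^sub>R v) < b e \<and> c e \<bullet> (x - t *\<^sub>R v) < b e"
    using small_step[of "I - T x" c x b v] finI by blast
  have inA: "x + s *\<^sub>R v \<in> A" for s
  proof -
    have "(1 - s) *\<^sub>R x + s *\<^sub>R (x + v) \<in> A"
      using affA v(1) xS unfolding affine_def S_def by auto
    then show ?thesis by (simp add: algebra_simps)
  qed
  have inS: "x + s *\<^sub>R v \<in> S" if "s = t \<or> s = - t" for s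
    unfolding S_def
  proof (intro CollectI conjI inA ballI)
    fix e assume "e \<in> I"
    then show "c e \<bullet> (x + s *\<^sub>R v) \<le> b e"
      using t(2)[of e] v(2)[of e] xS that by (cases "e \<in> T x") (auto simp: S_def inner_add_right inner_diff_right less_imp_le)
  qed
  have "x \<in> open_segment (x + t *\<^sub>R v) (x + (- t) *\<^sub>R v)"
  proof -
    have "midpoint (x + t *\<^sub>R v) (x + (- t) *\<^sub>R v) = x" by (simp add: midpoint_eq_iff)
    moreover have "x + t *\<^sub>R v \<noteq> x + (- t) *\<^sub>R v"
    proof
      assume "x + t *\<^sub>R v = x + (- t) *\<^sub>R v"
      then have "2 *\<^sub>R (t *\<^sub>R v) = 0" unfolding scaleR_2 by (simp add: eq_neg_iff_add_eq_0)
      then show False using t \<open>v \<noteq> 0\<close> by simp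
    qed
    ultimately show ?thesis using midpoint_in_open_segment by metis
  qed
  then show False using x inS unfolding extreme_point_of_def by blast
qed

text \<open>The dual vectors form a basis of the direction space of \<open>A\<close>, so the
  dimension is the number of active constraints. They also give a point where only one chosen
  constraint is active, so the active constraints define distinct facets.\<close>

lemma card_facets:
  assumes x: "x extreme_point_of S"
    and dual: "\<And>e. e \<in> T x \<Longrightarrow> \<exists>y. x + y \<in> A \<and> c e \<bullet> y = -1 \<and> (\<forall>f\<in>T x. f \<noteq> e \<longrightarrow> c f \<bullet> y = 0)"
  shows "int (card {F. F facet_of S \<and> x \<in> F}) = aff_dim S"
proof -
  have xS: "x \<in> S" using x by (simp add: extreme_point_of_def)
  then have xA: "x \<in> A" by (simp add: S_def)
  have finT: "finite (T x)" using finI by (simp add: T_def)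
  obtain y where y: "\<And>e. e \<in> T x \<Longrightarrow> x + y e \<in> A" "\<And>e. e \<in> T x \<Longrightarrow> c e \<bullet> y e = -1"
    "\<And>e f. e \<in> T x \<Longrightarrow> f \<in> T x \<Longrightarrow> f \<noteq> e \<Longrightarrow> c f \<bullet> y e = 0" using dual by metis
  define L where "L = (\<lambda>z. - x + z) ` A"
  have memL: "v \<in> L \<longleftrightarrow> x + v \<in> A" for v unfolding L_def by (force simp: image_iff)
  have subL: "subspace L" unfolding L_def using affine_diffs_subspace[OF affA xA] by simp
  have inj: "inj_on y (T x)" using y(2,3) by (intro inj_onI) (metis neg_equal_0_iff_equal zero_neq_one)
  have cy: "c e \<bullet> (\<Sum>f\<in>R. k f *\<^sub>R y f) = (if e \<in> R then - k e else 0)" if "e \<in> T x" "R \<subseteq> T x" for e R k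
  proof -
    have "c e \<bullet> (\<Sum>f\<in>R. k f *\<^sub>R y f) = (\<Sum>f\<in>R. if f = e then - k e else 0)"
      unfolding inner_sum_right using that y by (intro sum.cong refl) auto
    also have "\<dots> = (if e \<in> R then - k e else 0)"
      using finite_subset[OF that(2) finT] by simp
    finally show ?thesis .
  qed
  have "independent (y ` T x)"
    unfolding dependent_def
  proof (clarify)
    fix e assume e: "e \<in> T x" "y e \<in> span (y ` T x - {y e})"
    have "subspace {v. c e \<bullet> v = 0}" by (rule subspace_hyperplane)
    moreover have "y ` T x - {y e} \<subseteq> {v. c e \<bullet> v = 0}" using y(3) e(1) by force
    ultimately have "span (y ` T x - {y e}) \<subseteq> {v. c e \<bullet> v = 0}" by (rule span_minimal[rotated])
    then show False using e y(2)[of e] by auto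
  qed
  moreover have "span (y ` T x) = L"
  proof (intro equalityI subsetI)
    show "v \<in> L" if "v \<in> span (y ` T x)" for v
      using that span_minimal[OF _ subL, of "y ` T x"] y(1) memL by blast
    fix v assume v: "v \<in> L"
    \<comment> \<open>Because \<open>c e \<bullet> y e = -1\<close>, adding \<open>?s\<close>
      cancels the values of \<open>v\<close> on all active constraints.\<close>
    let ?s = "\<Sum>e\<in>T x. (c e \<bullet> v) *\<^sub>R y e"
    have "?s \<in> L" using y(1) memL by (intro subspace_sum subspace_scale subL) auto
    then have "v + ?s \<in> L" using v subL subspace_add by blast
    moreover have "c e \<bullet> (v + ?s) = 0" if "e \<in> T x" for e
      using cy[OF that order_refl] that by (simp add: inner_add_right)
    ultimately have "v + ?s = 0" using extreme_tight_zero[OF x] memL by blast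
    then have "v = - ?s" by (simp add: eq_neg_iff_add_eq_0)
    moreover have "?s \<in> span (y ` T x)" by (intro span_sum span_scale span_base) auto
    ultimately show "v \<in> span (y ` T x)" using span_neg by metis
  qed
  ultimately have "dim L = card (y ` T x)" using dim_span_eq_card_independent by blast
  then have dimL: "dim L = card (T x)" using card_image[OF inj] by simp
  have "aff_dim A = aff_dim L" unfolding L_def by (simp only: aff_dim_translation_eq)
  then have dimS: "aff_dim S = card (T x)" using aff_dim_subspace[OF subL] dimL aff_dim_S by simp
  have q: "\<exists>q\<in>A. c e \<bullet> q = b e \<and> (\<forall>f\<in>I. f \<noteq> e \<longrightarrow> c f \<bullet> q < b f)" if e: "e \<in> T x" for e
  proof -
    \<comment> \<open>This direction leaves all active constraints except \<open>e\<close>.\<close>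
    let ?v = "\<Sum>f\<in>T x - {e}. 1 *\<^sub>R y f"
    have "\<And>e. e \<in> I - T x \<Longrightarrow> c e \<bullet> x < b e" using xS by (auto simp: S_def T_def less_le)
    then obtain t where t: "t > 0" "\<And>e. e \<in> I - T x \<Longrightarrow> c e \<bullet> (x + t *\<^sub>R ?v) < b e"
      using small_step[of "I - T x" c x b ?v] finI by blast
    have "t *\<^sub>R ?v \<in> L" using y(1) memL by (intro subspace_sum subspace_scale subL) auto
    then have "x + t *\<^sub>R ?v \<in> A" using memL by simp
    moreover have "c e \<bullet> (x + t *\<^sub>R ?v) = b e" 
      using cy[OF e, of "T x - {e}" "\<lambda>_. 1"] e by (simp add: inner_add_right T_def)
    moreover have "c f \<bullet> (x + t *\<^sub>R ?v) < b f" if f: "f \<in> I" "f \<noteq> e" for f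
    proof (cases "f \<in> T x")
      case True
      then have "c f \<bullet> ?v = - 1" using cy[OF True, of "T x - {e}" "\<lambda>_. 1"] f by simp
      then have "c f \<bullet> (x + t *\<^sub>R ?v) = b f - t" using True by (simp only: inner_add_right inner_scaleR_right T_def) simp
      then show ?thesis using t(1) by simp
    qed (use f t in auto)
    ultimately show ?thesis by blast
  qed
  have facet: "H e facet_of S" if "e \<in> T x" for e
    using q[OF that] H_facet[of e] that by (auto simp: T_def)
  have "{F. F facet_of S \<and> x \<in> F} = H ` T x"
  proof (intro equalityI subsetI)
    fix C assume C: "C \<in> {F. F facet_of S \<and> x \<in> F}"
    then have "e \<in> T x" if "e \<in> I" "C \<subseteq> H e" for e using that by (auto simp: T_def H_def)
    then obtain e where "e \<in> I" "C = H e" "e \<in> T x" using facet_is_H[of C] C facet by blast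
    then show "C \<in> H ` T x" by blast
  next
    fix C assume "C \<in> H ` T x"
    then show "C \<in> {F. F facet_of S \<and> x \<in> F}" using facet xS by (auto simp: H_def T_def)
  qed
  moreover have "inj_on H (T x)"
  proof (intro inj_onI)
    fix e f assume ef: "e \<in> T x" "f \<in> T x" "H e = H f"
    obtain q where q: "q \<in> A" "c e \<bullet> q = b e" "\<And>f. f\<in>I \<Longrightarrow> f \<noteq> e \<Longrightarrow> c f \<bullet> q < b f" using q[OF ef(1)] by blast
    then have "q \<in> H e" by (auto simp: H_def S_def) (metis less_imp_le order_refl)
    then have "c f \<bullet> q = b f" using ef(3) by (auto simp: H_def)
    then show "e = f" using q(3)[of f] ef(2) by (auto simp: T_def)
  qed
  ultimately show ?thesis using dimS by (simp add: card_image)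
qed

end


section \<open>The convex hull and bounded faces\<close>

text \<open>A hull edge oriented counterclockwise. If there are only two points, both orientations
  qualify.\<close>

definition ccw_edge :: "('n::finite \<Rightarrow> real^2) \<Rightarrow> 'n \<Rightarrow> 'n \<Rightarrow> bool" where
  "ccw_edge p h k \<longleftrightarrow> h \<noteq> k \<and> (\<forall>x. x \<noteq> h \<and> x \<noteq> k \<longrightarrow> det3 (p h) (p k) (p x) > 0)"

definition rot :: "real^2 \<Rightarrow> real^2" where
  "rot e = (\<chi> m. if m = 1 then - e$2 else e$1)"

lemma cross2_rot: "cross2 e x = rot e \<bullet> x"
  by (simp add: cross2_def rot_def inner_vec_def sum_2)

lemma ccw_edge_hull_edge:
  assumes gp: "general_position p" and D: "ccw_edge p h k"
  shows "hull_edge p h k"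
proof -
  define a where "a = rot (p k - p h)"
  define \<beta> where "\<beta> = a \<bullet> p h"
  have det: "det3 (p h) (p k) x = a \<bullet> x - \<beta>" for x
    by (simp add: det3_cross2 cross2_rot a_def \<beta>_def inner_diff_right)
  have "affine hull {p h, p k} \<subseteq> {x. a \<bullet> x = \<beta>}"
    using det[of "p h"] det[of "p k"] by (intro hull_minimal affine_hyperplane) auto
  moreover have "convex hull (range p - {p h, p k}) \<subseteq> {x. a \<bullet> x > \<beta>}"
  proof (intro hull_minimal convex_halfspace_gt subsetI)
    fix y assume "y \<in> range p - {p h, p k}"
    then obtain x where "y = p x" "x \<noteq> h" "x \<noteq> k" by auto
    then show "y \<in> {x. a \<bullet> x > \<beta>}" using D det[of y] by (auto simp: ccw_edge_def)
  qed
  ultimately have "affine hull {p h, p k} \<inter> convex hull (range p - {p h, p k}) = {}" by fastforce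
  then show ?thesis using face_of_convex_hulls[of "range p" "{p h, p k}"] D
    by (auto simp: hull_edge_def ccw_edge_def)
qed

lemma inner_cross2_identity:
  fixes e u x :: "real^2"
  shows "(e \<bullet> e) * (u \<bullet> x) = (e \<bullet> u) * (e \<bullet> x) + cross2 e u * cross2 e x"
  by (simp add: cross2_def inner_vec_def sum_2 algebra_simps)

text \<open>A face of a polytope is exposed. The exposing functional is constant along the edge,
  hence proportional to the area over the edge.\<close>

lemma hull_edge_side:
  assumes gp: "general_position p" and he: "hull_edge p i j"
  shows "\<exists>s. s \<noteq> 0 \<and> (\<forall>k. s * det3 (p i) (p j) (p k) \<ge> 0)"
proof -
  have ij: "i \<noteq> j" and face: "convex hull {p i, p j} face_of convex hull (range p)"
    using he by (auto simp: hull_edge_def)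
  have "polyhedron (convex hull (range p))" by (simp add: polytope_convex_hull polytope_imp_polyhedron)
  then have "convex hull {p i, p j} exposed_face_of convex hull (range p)"
    using face exposed_face_of_polyhedron by blast
  then obtain a b where ab: "convex hull (range p) \<subseteq> {x. a \<bullet> x \<le> b}"
    "convex hull {p i, p j} = convex hull (range p) \<inter> {x. a \<bullet> x = b}"
    by (auto simp: exposed_face_of_def)
  have le: "a \<bullet> p k \<le> b" for k using ab(1) hull_inc[of "p k" "range p" convex] by auto
  have eq: "a \<bullet> p i = b" "a \<bullet> p j = b" using ab(2) hull_inc[of _ "{p i, p j}" convex] by auto
  show ?thesis
  \<comment> \<open>A zero functional exposes the whole hull; then only the two endpoints exist and
    all areas vanish.\<close>
  proof (cases "a = 0")
    case True
    then have "convex hull {p i, p j} = convex hull (range p)" using ab(2) eq by auto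
    then have "p k \<in> closed_segment (p i) (p j)" for k
      using hull_inc[of "p k" "range p" convex] by (simp add: segment_convex_hull)
    then have "k = i \<or> k = j" for k using vertex_in_segment[OF gp ij] by blast
    then have "det3 (p i) (p j) (p k) = 0" for k by (metis det3_repeat(2,3))
    then show ?thesis by (intro exI[of _ 1]) auto
  next
    case False
    define e where "e = p j - p i"
    have e: "e \<bullet> a = 0" using eq by (simp add: e_def inner_diff_right inner_commute)
    have e0: "e \<bullet> e > 0" using gp ij by (auto simp: e_def general_position_def dest: injD)
    have id: "(e \<bullet> e) * (a \<bullet> x) = cross2 e a * cross2 e x" for x
      using inner_cross2_identity[of e a x] e by simp
    have "cross2 e a \<noteq> 0" using id[of a] e0 False by auto
    moreover have "- cross2 e a * det3 (p i) (p j) (p k) \<ge> 0" for k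
    proof -
      have "- cross2 e a * det3 (p i) (p j) (p k) = - ((e \<bullet> e) * (a \<bullet> (p k - p i)))"
        unfolding id by (simp add: det3_cross2 e_def)
      moreover have "(e \<bullet> e) * (a \<bullet> (p k - p i)) \<le> 0"
        using le[of k] eq e0 by (intro mult_nonneg_nonpos) (auto simp: inner_diff_right)
      ultimately show ?thesis by simp
    qed
    ultimately show ?thesis by (intro exI[of _ "- cross2 e a"]) auto
  qed
qed

text \<open>In the open half-plane left of \<open>e\<close>, \<open>q\<close> is the cotangent of
  the angle from \<open>e\<close>, which decreases with the angle; its maximum is the clockwise-most
  direction.\<close>

lemma clockwise_most:
  assumes "finite M" "M \<noteq> {}" "\<And>x. x \<in> M \<Longrightarrow> cross2 e (w x) > 0"
  shows "\<exists>l\<in>M. \<forall>x\<in>M. cross2 (w l) (w x) \<ge> 0"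
proof -
  define q where "q x = (e \<bullet> w x) / cross2 e (w x)" for x
  have "Max (q ` M) \<in> q ` M" using assms by (intro Max_in) auto
  then obtain l where l: "l \<in> M" "q l = Max (q ` M)" by auto
  have "cross2 (w l) (w x) \<ge> 0" if x: "x \<in> M" for x
  proof -
    have "q x \<le> q l" using l(2) x assms(1) by simp
    then have "(e \<bullet> w x) * cross2 e (w l) \<le> (e \<bullet> w l) * cross2 e (w x)"
      using assms(3)[OF x] assms(3)[OF l(1)] by (simp add: q_def divide_simps mult.commute)
    moreover have "(e \<bullet> e) * cross2 (w l) (w x) = (e \<bullet> w l) * cross2 e (w x) - (e \<bullet> w x) * cross2 e (w l)"
      by (simp add: cross2_def inner_vec_def sum_2 algebra_simps)
    ultimately have "(e \<bullet> e) * cross2 (w l) (w x) \<ge> 0" by simp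
    moreover have "e \<bullet> e > 0" using assms(3)[OF x] by auto
    ultimately show ?thesis by (simp add: zero_le_mult_iff)
  qed
  then show ?thesis using l by blast
qed

text \<open>Gift wrapping: from \<open>k\<close> all other points lie left of the line of the last
  edge, and the clockwise-most one continues the boundary. With two points the boundary turns back
  to \<open>h\<close>.\<close>

lemma ccw_edge_next:
  assumes gp: "general_position p" and D: "ccw_edge p h k"
  shows "\<exists>l. ccw_edge p k l"
proof (cases "\<exists>x. x \<noteq> h \<and> x \<noteq> k")
  case False
  then show ?thesis using D by (intro exI[of _ h]) (auto simp: ccw_edge_def)
next
  case True
  define e where "e = p k - p h"
  let ?M = "{x. x \<noteq> h \<and> x \<noteq> k}" and ?w = "\<lambda>x. p x - p k"
  have pos: "cross2 e (?w x) > 0" if "x \<in> ?M" for x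
  proof -
    have "cross2 e (?w x) = det3 (p h) (p k) (p x)" by (simp add: e_def cross2_def det3_def algebra_simps)
    then show ?thesis using D that by (auto simp: ccw_edge_def)
  qed
  then obtain l where l: "l \<in> ?M" "\<And>x. x \<in> ?M \<Longrightarrow> cross2 (?w l) (?w x) \<ge> 0"
    using clockwise_most[of ?M e ?w] True by auto
  have "ccw_edge p k l" unfolding ccw_edge_def
  proof (intro conjI allI impI)
    show "k \<noteq> l" using l(1) by auto
    fix x assume x: "x \<noteq> k \<and> x \<noteq> l"
    show "det3 (p k) (p l) (p x) > 0"
    proof (cases "x = h")
      case True
      have "det3 (p k) (p l) (p h) = cross2 e (?w l)" by (simp add: e_def cross2_def det3_def algebra_simps)
      then show ?thesis using pos[OF l(1)] True by simp
    next
      case False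
      then have "det3 (p k) (p l) (p x) \<ge> 0" using l(2)[of x] x by (simp add: det3_cross2)
      moreover have "det3 (p k) (p l) (p x) \<noteq> 0" using general_position_det3[OF gp] x l(1) by auto
      ultimately show ?thesis by simp
    qed
  qed
  then show ?thesis by blast
qed

text \<open>Gift wrapping starts at a lowest point; if a second point has the same height, the two
  span a horizontal edge, oriented from left to right.\<close>

lemma ccw_edge_exists:
  fixes p :: "'n::finite \<Rightarrow> real^2" and o1 o2 :: 'n
  assumes gp: "general_position p" and o: "o1 \<noteq> o2"
  shows "\<exists>h k. ccw_edge p h k"
proof -
  have "Min (range (\<lambda>x. p x $ 2)) \<in> range (\<lambda>x. p x $ 2)" by (intro Min_in) auto
  then obtain h where h: "p h $ 2 = Min (range (\<lambda>x. p x $ 2))" by (metis (mono_tags, lifting) imageE)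
  have hle: "p h $ 2 \<le> p x $ 2" for x using h by simp
  show ?thesis
  proof (cases "\<exists>x. x \<noteq> h \<and> p x $ 2 = p h $ 2")
    case True
    then obtain x where x: "x \<noteq> h" "p x $ 2 = p h $ 2" by blast
    have "p x \<noteq> p h" using gp x(1) by (auto simp: general_position_def dest: injD)
    then have x1: "p x $ 1 \<noteq> p h $ 1" using x(2) by (simp add: vec_eq_iff forall_2)
    have det: "det3 (p h) (p x) (p y) = (p x $ 1 - p h $ 1) * (p y $ 2 - p h $ 2)" for y
      using x by (simp add: det3_def)
    have nz: "p y $ 2 - p h $ 2 > 0" if "y \<noteq> h" "y \<noteq> x" for y
      using det[of y] general_position_det3[OF gp, of h x y] x that hle[of y] by auto
    show ?thesis
    proof (cases "p x $ 1 > p h $ 1")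
      case True
      then have "ccw_edge p h x" using det nz x by (auto simp: ccw_edge_def)
      then show ?thesis by blast
    next
      case False
      have "det3 (p x) (p h) (p y) = (p h $ 1 - p x $ 1) * (p y $ 2 - p h $ 2)" for y
        using x by (simp add: det3_def algebra_simps)
      then have "ccw_edge p x h" using nz x x1 False by (auto simp: ccw_edge_def intro!: mult_pos_pos)
      then show ?thesis by blast
    qed
  next
    case False
    let ?e = "axis 1 1 :: real^2" and ?w = "\<lambda>x. p x - p h" and ?M = "{x. x \<noteq> h}"
    have pos: "cross2 ?e (?w x) > 0" if "x \<in> ?M" for x
      using False hle[of x] that by (auto simp: cross2_def axis_def less_le)
    have "o1 \<in> ?M \<or> o2 \<in> ?M" using o by auto
    then have "?M \<noteq> {}" by (metis empty_iff)
    then have "\<exists>l\<in>?M. \<forall>x\<in>?M. cross2 (?w l) (?w x) \<ge> 0"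
      by (rule clockwise_most[OF finite _ pos])
    then obtain l where l: "l \<in> ?M" "\<And>x. x \<in> ?M \<Longrightarrow> cross2 (?w l) (?w x) \<ge> 0" by blast
    have det: "det3 (p h) (p l) (p x) > 0" if "x \<noteq> h" "x \<noteq> l" for x
    proof -
      have "det3 (p h) (p l) (p x) \<ge> 0" using l(2)[of x] that by (simp add: det3_cross2)
      moreover have "det3 (p h) (p l) (p x) \<noteq> 0" using general_position_det3[OF gp, of h l x] l(1) that by simp
      ultimately show ?thesis by simp
    qed
    have "ccw_edge p h l" unfolding ccw_edge_def using det l(1) by simp
    then show ?thesis by blast
  qed
qed

lemma ccw_edge_unique:
  assumes "ccw_edge p g k" "ccw_edge p h k"
  shows "g = h"
proof (rule ccontr)
  assume "g \<noteq> h"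
  then have "det3 (p g) (p k) (p h) > 0" "det3 (p h) (p k) (p g) > 0" using assms by (auto simp: ccw_edge_def)
  then show False by (simp add: det3_def algebra_simps)
qed

lemma perpendicular_rot:
  assumes "e \<noteq> 0" "e \<bullet> u = 0"
  shows "u = (cross2 e u / (e \<bullet> e)) *\<^sub>R rot e"
proof -
  have "(e \<bullet> e) *\<^sub>R u = (e \<bullet> u) *\<^sub>R e + cross2 e u *\<^sub>R rot e"
    by (simp add: vec_eq_iff forall_2 rot_def cross2_def inner_vec_def sum_2 algebra_simps)
  then have "(1 / (e \<bullet> e)) *\<^sub>R ((e \<bullet> e) *\<^sub>R u) = (1 / (e \<bullet> e)) *\<^sub>R (cross2 e u *\<^sub>R rot e)" using assms(2) by simp
  then show ?thesis using assms(1) by simp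
qed

lemma rot_diff: "rot (x - y) = rot x - rot y"
  by (simp add: rot_def vec_eq_iff)

lemma inner_rot_self: "x \<bullet> rot x = 0"
  by (simp add: rot_def inner_vec_def sum_2)

text \<open>The angular velocities of the hull edges are weakly decreasing in cyclic order, hence equal on the part of
  the boundary where the minimum is attained; after subtracting a rigid motion this part is at rest, and then no
  other point can move away from all of it.\<close>

lemma expansive_hull_rigid:
  fixes p :: "'n::finite \<Rightarrow> real^2" and o1 o2 :: 'n
  assumes gp: "general_position p" and o: "o1 \<noteq> o2"
    and expansive: "\<And>i j. rig p v $ (i, j) \<ge> 0"
    and hull: "\<And>h k. ccw_edge p h k \<Longrightarrow> rig p v $ (h, k) = 0"
  shows "rig p v = 0"
proof -
  let ?V = "{h. \<exists>k. ccw_edge p k h}"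
  have "\<forall>h\<in>?V. \<exists>k. ccw_edge p h k" using ccw_edge_next[OF gp] by blast
  then obtain s where s: "\<And>h. h \<in> ?V \<Longrightarrow> ccw_edge p h (s h)" by metis
  have sV: "s h \<in> ?V" if "h \<in> ?V" for h using s[OF that] by blast
  \<comment> \<open>The angular velocity of a hull edge: its length is stationary, so its endpoints
    differ by a multiple of the rotated edge.\<close>
  define \<alpha> where "\<alpha> h = cross2 (p (s h) - p h) (v $ s h - v $ h) / ((p (s h) - p h) \<bullet> (p (s h) - p h))" for h
  have mot: "v $ s h - v $ h = \<alpha> h *\<^sub>R rot (p (s h) - p h)" if "h \<in> ?V" for h
    unfolding \<alpha>_def
  proof (rule perpendicular_rot)
    show "p (s h) - p h \<noteq> 0" using s[OF that] gp by (auto simp: ccw_edge_def general_position_def dest: injD)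
    show "(p (s h) - p h) \<bullet> (v $ s h - v $ h) = 0"
      using hull[OF s[OF that]] by (simp add: inner_diff_left inner_diff_right)
  qed
  have mono: "\<alpha> (s h) \<le> \<alpha> h" if h: "h \<in> ?V" for h
  proof (cases "s (s h) = h")
    case True
    have "\<alpha> (s h) = \<alpha> h" unfolding \<alpha>_def True
      by (simp add: cross2_def inner_vec_def sum_2 algebra_simps)
    then show ?thesis by simp
  next
    case False
    define e f where "e = p (s h) - p h" and "f = p (s (s h)) - p (s h)"
    have "cross2 e f = det3 (p h) (p (s h)) (p (s (s h)))"
      by (simp add: e_def f_def cross2_def det3_def algebra_simps)
    then have pos: "cross2 e f > 0"
      using s[OF h] s[OF sV[OF h]] False by (auto simp: ccw_edge_def)
    \<comment> \<open>The chord across two consecutive hull edges may not shrink; its expansion is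
      the drop of \<alpha> times the positive turn between the edges.\<close>
    have "rig p v $ (s (s h), h) = (e + f) \<bullet> ((v $ s h - v $ h) + (v $ s (s h) - v $ s h))"
      by (simp add: e_def f_def)
    also have "\<dots> = (\<alpha> h - \<alpha> (s h)) * cross2 e f"
      unfolding mot[OF h] mot[OF sV[OF h]] e_def[symmetric] f_def[symmetric]
      by (simp add: rot_def cross2_def inner_vec_def sum_2 algebra_simps)
    finally have "(\<alpha> h - \<alpha> (s h)) * cross2 e f \<ge> 0" using expansive by metis
    then show ?thesis using pos by (simp add: zero_le_mult_iff)
  qed
  have Vne: "?V \<noteq> {}" using ccw_edge_exists[OF gp o] by blast
  define \<mu> where "\<mu> = Min (\<alpha> ` ?V)"
  have "\<mu> \<in> \<alpha> ` ?V" unfolding \<mu>_def using Vne by (intro Min_in) auto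
  then obtain h0 where h0: "h0 \<in> ?V" "\<alpha> h0 = \<mu>" by auto
  have \<mu>le: "\<mu> \<le> \<alpha> h" if "h \<in> ?V" for h unfolding \<mu>_def using that by simp
  \<comment> \<open>Subtracting the rotation of speed \<mu> and the translation \<open>c\<close>
    puts \<open>h0\<close> at rest without changing \<open>rig\<close>.\<close>
  define c where "c = v $ h0 - \<mu> *\<^sub>R rot (p h0)"
  define w where "w x = v $ x - \<mu> *\<^sub>R rot (p x) - c" for x
  define Q where "Q = {h \<in> ?V. \<alpha> h = \<mu> \<and> w h = 0}"
  have Qs: "s h \<in> Q" if "h \<in> Q" for h
  proof -
    have h: "h \<in> ?V" "\<alpha> h = \<mu>" "w h = 0" using that by (auto simp: Q_def)
    have "\<alpha> (s h) = \<mu>" using mono[OF h(1)] \<mu>le[OF sV[OF h(1)]] h(2) by simp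
    moreover have "w (s h) = w h" using mot[OF h(1)] h(2)
      by (simp add: w_def rot_diff algebra_simps)
    ultimately show ?thesis using sV[OF h(1)] h(3) by (simp add: Q_def)
  qed
  have h0Q: "h0 \<in> Q" using h0 by (simp add: Q_def w_def c_def)
  have "inj_on s Q"
  proof (rule inj_onI)
    fix g h assume "g \<in> Q" "h \<in> Q" "s g = s h"
    then have "ccw_edge p g (s h)" "ccw_edge p h (s h)" using s[of g] s[of h] by (auto simp: Q_def)
    then show "g = h" by (rule ccw_edge_unique)
  qed
  \<comment> \<open>Every member of \<open>Q\<close> thus has its predecessor, as well as its
    successor, in \<open>Q\<close>.\<close>
  then have surj: "s ` Q = Q" using Qs by (intro endo_inj_surj) auto
  have rigw: "rig p v $ (i, j) = (p i - p j) \<bullet> (w i - w j)" for i j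
  proof -
    have "w i - w j = (v $ i - v $ j) - \<mu> *\<^sub>R rot (p i - p j)" by (simp add: w_def rot_diff algebra_simps)
    then show ?thesis by (simp add: inner_diff_right[of _ "_ - _"] inner_rot_self)
  qed
  have "w x = 0" for x
  proof (cases "x \<in> Q")
    case False
    \<comment> \<open>At the resting vertex \<open>h\<close> farthest in direction
      \<open>w x\<close>, both neighbours are at rest and not farther, and \<open>x\<close> lies in
      the open cone they span. So \<open>x\<close> cannot move away from \<open>h\<close> unless its
      velocity vanishes.\<close>
    have "Max ((\<lambda>h. w x \<bullet> p h) ` Q) \<in> (\<lambda>h. w x \<bullet> p h) ` Q" using h0Q by (intro Max_in) auto
    then obtain h where h: "h \<in> Q" "w x \<bullet> p h = Max ((\<lambda>h. w x \<bullet> p h) ` Q)" by auto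
    have hmax: "w x \<bullet> p k \<le> w x \<bullet> p h" if "k \<in> Q" for k using h(2) that by simp
    obtain g where g: "g \<in> Q" "s g = h" using surj h(1) by (metis imageE)
    have Dg: "ccw_edge p g h" and Dh: "ccw_edge p h (s h)" using s g h(1) by (auto simp: Q_def)
    define e f q where "e = p (s h) - p h" and "f = p g - p h" and "q = p x - p h"
    have xne: "x \<noteq> g" "x \<noteq> h" "x \<noteq> s h" using False g(1) h(1) Qs by auto
    have "det3 (p h) (p (s h)) (p x) > 0" using Dh xne by (simp add: ccw_edge_def)
    then have eq: "cross2 e q > 0" by (simp add: e_def q_def det3_cross2)
    have dg: "det3 (p g) (p h) (p x) > 0" using Dg xne by (simp add: ccw_edge_def)
    then have qf: "cross2 q f > 0" by (simp add: f_def q_def cross2_def det3_def algebra_simps)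
    have "g \<noteq> s h"
    proof
      assume "g = s h"
      then have "det3 (p h) (p g) (p x) > 0" using Dh xne by (simp add: ccw_edge_def)
      then show False using dg by (simp add: det3_def algebra_simps)
    qed
    then have "det3 (p h) (p (s h)) (p g) > 0" using Dh Dg by (auto simp: ccw_edge_def)
    then have ef: "cross2 e f > 0" by (simp add: e_def f_def det3_cross2)
    have we: "e \<bullet> w x \<le> 0" and wf: "f \<bullet> w x \<le> 0"
      using hmax[OF Qs[OF h(1)]] hmax[OF g(1)] by (auto simp: e_def f_def inner_diff_right inner_commute[of _ "w x"])
    have "q \<bullet> w x \<ge> 0" using expansive[of x h] rigw[of x h] h(1) by (simp add: Q_def q_def)
    then have "cross2 e f * (q \<bullet> w x) \<ge> 0" using ef by simp
    moreover have "cross2 e f * (q \<bullet> w x) = cross2 q f * (e \<bullet> w x) + cross2 e q * (f \<bullet> w x)"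
      by (simp add: cross2_def inner_vec_def sum_2 algebra_simps)
    moreover have "cross2 q f * (e \<bullet> w x) \<le> 0" "cross2 e q * (f \<bullet> w x) \<le> 0"
      using we wf eq qf by (auto intro!: mult_nonneg_nonpos)
    ultimately have "cross2 q f * (e \<bullet> w x) = 0" "cross2 e q * (f \<bullet> w x) = 0" by linarith+
    then have "e \<bullet> w x = 0" "f \<bullet> w x = 0" using eq qf by auto
    then show ?thesis using independent_inner_zero[of e f "w x"] ef by simp
  qed (simp add: Q_def)
  then have "rig p v $ (i, j) = 0" for i j using rigw[of i j] by simp
  then show ?thesis by (auto simp: vec_eq_iff[of "rig p v"])
qed

text \<open>A limit of normalized points of growing norm: dividing an upper bound of a functional by
  these norms leaves 0.\<close>

lemma unbounded_direction:
  fixes S :: "'a::euclidean_space set"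
  assumes "\<not> bounded S"
  obtains r where "norm r = 1" "\<And>g c. linear g \<Longrightarrow> (\<And>x. x \<in> S \<Longrightarrow> g x \<le> c) \<Longrightarrow> g r \<le> (0::real)"
proof -
  have "\<exists>x\<in>S. norm x > real (Suc n)" for n
    using assms unfolding bounded_iff by (meson not_le)
  then obtain x where x: "\<And>n. x n \<in> S" "\<And>n. norm (x n) > real (Suc n)" by metis
  define y where "y n = (1 / norm (x n)) *\<^sub>R x n" for n
  have xpos: "norm (x n) > 0" for n using x(2)[of n] by (metis less_trans of_nat_0_less_iff zero_less_Suc)
  have "y n \<in> sphere 0 1" for n using xpos[of n] by (simp add: y_def)
  then obtain r f where r: "r \<in> sphere 0 1" "strict_mono f" "(y \<circ> f) \<longlonglongrightarrow> r"
    using compact_sphere[of "0::'a" 1] unfolding compact_def by blast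
  have le: "g r \<le> 0" if g: "linear g" "\<And>x. x \<in> S \<Longrightarrow> g x \<le> c" for g :: "'a \<Rightarrow> real" and c
  proof -
    have lim: "(\<lambda>n. g ((y \<circ> f) n)) \<longlonglongrightarrow> g r"
      by (rule isCont_tendsto_compose[OF linear_continuous_at r(3)]) (simp add: g(1) linear_conv_bounded_linear[symmetric])
    have "g ((y \<circ> f) n) \<le> \<bar>c\<bar> / real (Suc n)" for n
    proof -
      have "g ((y \<circ> f) n) = g (x (f n)) / norm (x (f n))"
        by (simp add: y_def linear_scale[OF g(1)])
      also have "\<dots> \<le> \<bar>c\<bar> / norm (x (f n))"
        using g(2)[OF x(1)[of "f n"]] by (intro divide_right_mono) auto
      also have "\<dots> \<le> \<bar>c\<bar> / real (Suc n)"
        using x(2)[of "f n"] seq_suble[OF r(2), of n] by (intro divide_left_mono mult_pos_pos xpos) auto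
      finally show ?thesis .
    qed
    moreover have "(\<lambda>n. \<bar>c\<bar> / real (Suc n)) \<longlonglongrightarrow> 0"
      by (rule LIMSEQ_Suc[OF lim_const_over_n])
    ultimately show ?thesis using LIMSEQ_le[OF lim] by blast
  qed
  show ?thesis
  proof (rule that)
    show "norm r = 1" using r(1) by simp
  qed (rule le)
qed

text \<open>A recession direction \<open>r\<close> satisfies the homogeneous equations, so
  \<open>- r\<close> comes from a motion; it is expansive and fixes the hull edges, hence
  \<open>r\<close> would be 0.\<close>

lemma bounded_hull_face:
  fixes p :: "'n::finite \<Rightarrow> real^2" and o1 o2 :: 'n
  assumes gp: "general_position p" and o: "o1 \<noteq> o2" "(p o1)$2 \<noteq> (p o2)$2"
  shows "bounded (Yset p \<inter> {d. \<forall>i j. hull_edge p i j \<longrightarrow> d$(i,j) = 0})" (is "bounded ?F")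
proof (rule ccontr)
  assume "\<not> bounded ?F"
  then obtain r where r: "norm r = 1" "\<And>g c. linear g \<Longrightarrow> (\<And>x. x \<in> ?F \<Longrightarrow> g x \<le> c) \<Longrightarrow> g r \<le> (0::real)"
    using unbounded_direction by blast
  have req: "g r = 0" if "linear g" "\<And>x. x \<in> ?F \<Longrightarrow> g x = c" for g :: "real^('n \<times> 'n) \<Rightarrow> real" and c
    using r(2)[of g c] r(2)[of "\<lambda>x. - g x" "- c"] linear_compose_neg[OF that(1)] that by force
  have lin: "linear (\<lambda>x::real^('n \<times> 'n). x $ e)" for e by (rule linearI) auto
  have "r \<in> motion_space p" unfolding motion_space_def
  proof (intro CollectI conjI allI impI)
    fix i j
    have "linear (\<lambda>x::real^('n \<times> 'n). x$(i,j) - x$(j,i))" by (rule linear_compose_sub[OF lin lin])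
    then have "r$(i,j) - r$(j,i) = 0" using req[of "\<lambda>x. x$(i,j) - x$(j,i)" 0] by (simp add: Yset_def)
    then show "r$(i,j) = r$(j,i)" by simp
    show "r$(i,i) = 0" using req[OF lin, of "(i,i)" 0] by (simp add: Yset_def)
    fix k l assume "distinct [i, j, k, l]"
    then show "quad_sum p r i j k l = 0" using req[OF linear_quad_sum, of p i j k l 1] by (simp add: Yset_def)
  qed
  then obtain v where v: "rig p v = - r"
    using rig_surj_normalized[OF assms] subspace_neg[OF subspace_motion_space] by blast
  have "rig p v = 0"
  proof (rule expansive_hull_rigid[OF gp o(1)])
    fix i j
    have "r $ (i, j) \<le> 0" using r(2)[OF lin, of "(i, j)" 0] by (cases "i = j") (auto simp: Yset_def)
    then show "rig p v $ (i, j) \<ge> 0" unfolding v by simp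
    show "rig p v $ (i, j) = 0" if "ccw_edge p i j"
      using req[OF lin, of "(i, j)" 0] ccw_edge_hull_edge[OF gp that] unfolding v by simp
  qed
  then show False using v r(1) by simp
qed


section \<open>The polyhedron\<close>

lemma affine_Yspace: "affine (Yspace p)"
  unfolding affine_def
proof (intro ballI allI impI)
  fix x y and u v :: real assume xy: "x \<in> Yspace p" "y \<in> Yspace p" "u + v = 1"
  have "x + v *\<^sub>R (y - x) \<in> Yspace p"
    by (intro Yspace_add subspace_scale subspace_motion_space Yspace_diff xy)
  moreover have "u = 1 - v" using xy(3) by simp
  ultimately show "u *\<^sub>R x + v *\<^sub>R y \<in> Yspace p" by (simp only:) (simp add: algebra_simps)
qed

text \<open>Uniform expansion makes every inequality strict.\<close>

lemma Yspace_strict_point: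
  assumes gp: "general_position p"
  shows "\<exists>d\<in>Yspace p. \<forall>i j. i \<noteq> j \<longrightarrow> d$(i,j) < 0"
proof -
  let ?f = "fval 0 0 p"
  \<comment> \<open>The motion \<open>K *\<^sub>R p i\<close> expands each pair by \<open>K\<close>
    times its squared distance; the summand 1 makes the bound strict. The base points 0 are a free
    choice, since \<open>Yspace\<close> does not involve them.\<close>
  define K where "K = Max (range (\<lambda>(i, j). \<bar>?f i j\<bar> / ((p i - p j) \<bullet> (p i - p j)))) + 1"
  let ?v = "\<chi> i. K *\<^sub>R p i"
  have "dmap ?f p ?v $ (i, j) < 0" if "i \<noteq> j" for i j
  proof -
    have pos: "(p i - p j) \<bullet> (p i - p j) > 0" using gp that by (auto simp: general_position_def dest: injD)
    have "\<bar>?f i j\<bar> / ((p i - p j) \<bullet> (p i - p j)) \<le> Max (range (\<lambda>(i, j). \<bar>?f i j\<bar> / ((p i - p j) \<bullet> (p i - p j))))"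
      by (rule Max_ge) (auto intro!: image_eqI[of _ _ "(i, j)"])
    then have "\<bar>?f i j\<bar> / ((p i - p j) \<bullet> (p i - p j)) < K" by (simp add: K_def)
    then have "?f i j < K * ((p i - p j) \<bullet> (p i - p j))" using pos by (simp add: pos_divide_less_eq)
    moreover have "dmap ?f p ?v $ (i, j) = ?f i j - K * ((p i - p j) \<bullet> (p i - p j))"
      by (simp add: dmap_def scaleR_diff_right[symmetric])
    ultimately show ?thesis by simp
  qed
  then show ?thesis using dmap_in_Yspace[OF gp, of 0 0 ?v] by blast
qed

theorem theorem5p3:
  fixes p :: "'n::finite \<Rightarrow> real^2" and a b :: "real^2" and o1 o2 :: 'n
  assumes "general_position p"
    and "o1 \<noteq> o2"
    and "(p o1)$2 \<noteq> (p o2)$2"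
  defines "f \<equiv> fval a b p"
  defines "F \<equiv> Yset p \<inter> {d. \<forall>i j. hull_edge p i j \<longrightarrow> d$(i,j) = 0}"
  shows "simple_polyhedron (Yset p)
     \<and> affine_map (dmap f p) \<and> bij_betw (dmap f p) (Xbar f p o1 o2) (Yset p)
     \<and> F face_of Yset p \<and> bounded F
     \<and> (\<forall>G. G face_of Yset p \<and> bounded G \<longrightarrow> G \<subseteq> F)
     \<and> bij_betw (dmap f p) (Xf f p o1 o2) F"
proof -
  note gp = assms(1)
  \<comment> \<open>An enumeration selects one order of each pair. With both orders each facet would
    carry two active constraints, and the dual vectors could not exist.\<close>
  obtain num :: "'n \<Rightarrow> nat" where num: "inj num"
    using finite_imp_inj_to_nat_seg[OF finite] by blast
  define I where "I = {(i, j). num i < num j}"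
  obtain x0 where x0: "x0 \<in> Yspace p" "\<And>i j. i \<noteq> j \<Longrightarrow> x0$(i,j) < 0" using Yspace_strict_point[OF gp] by blast
  interpret Y: affine_system "Yspace p" I "\<lambda>e. axis e 1" "\<lambda>_. 0" x0
  proof
    show "axis e 1 \<bullet> x0 < 0" if "e \<in> I" for e
    proof -
      have "fst e \<noteq> snd e" using that by (auto simp: I_def)
      then show ?thesis using x0(2)[of "fst e" "snd e"] by (simp add: inner_axis')
    qed
  qed (use affine_Yspace x0 in auto)
  have ax: "axis e 1 \<bullet> x = x $ e" for e and x :: "real^('n \<times> 'n)" by (simp add: inner_axis')
  have Ine: "(i, j) \<in> I \<Longrightarrow> i \<noteq> j" for i j by (auto simp: I_def)
  have Iij: "(i, j) \<in> I \<or> (j, i) \<in> I" if "i \<noteq> j" for i j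
  proof -
    have "num i \<noteq> num j" using that num by (simp add: inj_eq)
    then show ?thesis by (simp add: I_def neq_iff)
  qed
  have sym: "x$(i,j) = x$(j,i)" if "x \<in> Yspace p" for x i j using that unfolding Yspace_def by blast
  have YS: "Yset p = Y.S"
  proof -
    have "(\<forall>i j. i \<noteq> j \<longrightarrow> x$(i,j) \<le> 0) \<longleftrightarrow> (\<forall>e\<in>I. x$e \<le> 0)" if "x \<in> Yspace p" for x
    proof (intro iffI ballI allI impI)
      fix i j :: 'n assume "\<forall>e\<in>I. x$e \<le> 0" "i \<noteq> j"
      then show "x$(i,j) \<le> 0" using Iij[of i j] sym[OF that, of i j] by auto
    next
      fix e assume "\<forall>i j. i \<noteq> j \<longrightarrow> x$(i,j) \<le> 0" "e \<in> I"
      then show "x$e \<le> 0" using Ine by (cases e) blast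
    qed
    then show ?thesis unfolding Yset_eq Y.S_def ax by (intro Collect_cong conj_cong refl)
  qed
  have tightT: "(i, j) \<in> Y.T x \<longleftrightarrow> (i, j) \<in> I \<and> tight x i j" for x i j
    unfolding Y.T_def ax tight_def using Ine[of i j] by blast
  have simple: "simple_polyhedron (Yset p)"
    unfolding simple_polyhedron_def YS
  proof (intro conjI allI impI Y.polyhedron_S Y.card_facets)
    fix x e assume x: "x extreme_point_of Y.S" and e: "e \<in> Y.T x"
    have xY: "x \<in> Yset p" using x by (simp add: YS extreme_point_of_def)
    then have xA: "x \<in> Yspace p" by (simp add: Yset_eq)
    obtain i j where ij: "e = (i, j)" by (cases e)
    have t: "tight x i j" "(i, j) \<in> I" using e tightT ij by auto
    obtain v where v: "rig p v $ (i, j) = 1" "\<And>k l. tight x k l \<Longrightarrow> {k, l} \<noteq> {i, j} \<Longrightarrow> rig p v $ (k, l) = 0"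
      using pointed_noncrossing_dual[OF gp tight_pointed_noncrossing[OF xY gp] t(1)] by blast
    show "\<exists>y. x + y \<in> Yspace p \<and> axis e 1 \<bullet> y = -1 \<and> (\<forall>f\<in>Y.T x. f \<noteq> e \<longrightarrow> axis f 1 \<bullet> y = 0)"
    proof (intro exI[of _ "- rig p v"] conjI ballI impI)
      show "x + - rig p v \<in> Yspace p"
        by (intro Yspace_add xA subspace_neg subspace_motion_space rig_in_motion_space gp)
      show "axis e 1 \<bullet> - rig p v = - 1" unfolding ax using v(1) ij by simp
      fix f assume f: "f \<in> Y.T x" "f \<noteq> e"
      obtain k l where kl: "f = (k, l)" by (cases f)
      have "tight x k l" "(k, l) \<in> I" using f tightT kl by auto
      moreover have "{k, l} \<noteq> {i, j}" using f(2) t(2) \<open>(k, l) \<in> I\<close> ij kl by (auto simp: doubleton_eq_iff I_def)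
      ultimately show "axis f 1 \<bullet> - rig p v = 0" unfolding ax kl using v(2) by simp
    qed
  qed
  have extF: "x \<in> F" if x: "x extreme_point_of Yset p" for x
  proof -
    have xY: "x \<in> Yset p" using x by (simp add: extreme_point_of_def)
    then have xA: "x \<in> Yspace p" by (simp add: Yset_eq)
    have "x$(i,j) = 0" if he: "hull_edge p i j" for i j
    proof (rule ccontr)
      assume nz: "x$(i,j) \<noteq> 0"
      obtain s where s: "s \<noteq> 0" "\<And>k. s * det3 (p i) (p j) (p k) \<ge> 0" using hull_edge_side[OF gp he] by blast
      have "i \<noteq> j" using he by (simp add: hull_edge_def)
      \<comment> \<open>If the hull edge is not tight, enlarging the tight graph by it yields a
        nonzero motion that preserves all tight entries, contrary to extremality.\<close>
      have pn: "pointed_noncrossing p (\<lambda>k l. tight x k l \<or> {k, l} = {i, j})"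
        by (rule pointed_noncrossing_insert_extremal[OF gp tight_pointed_noncrossing[OF xY gp] \<open>i \<noteq> j\<close> s])
      obtain v where v: "rig p v $ (i, j) = 1" "\<And>k l. tight x k l \<Longrightarrow> {k, l} \<noteq> {i, j} \<Longrightarrow> rig p v $ (k, l) = 0"
        using pointed_noncrossing_dual[OF gp pn disjI2[OF refl]] by blast
      have "rig p v = 0"
      proof (rule Y.extreme_tight_zero)
        show "x extreme_point_of Y.S" using x YS by simp
        show "x + rig p v \<in> Yspace p" by (intro Yspace_add xA rig_in_motion_space gp)
        fix e assume "e \<in> Y.T x"
        moreover obtain k l where kl: "e = (k, l)" by (cases e)
        ultimately have t: "tight x k l" using tightT by auto
        then have "{k, l} \<noteq> {i, j}" using nz sym[OF xA, of i j] by (auto simp: tight_def doubleton_eq_iff)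
        then show "axis e 1 \<bullet> rig p v = 0" unfolding ax kl using v(2) t by blast
      qed
      then show False using v(1) by simp
    qed
    then show ?thesis using xY by (simp add: F_def)
  qed
  have cl: "closed (Yset p)" and cv: "convex (Yset p)"
    unfolding YS using Y.polyhedron_S polyhedron_imp_closed Y.convex_S by auto
  have faceF: "F face_of Yset p"
  proof -
    let ?\<F> = "insert (Yset p) {Yset p \<inter> {d. axis (i, j) 1 \<bullet> d = 0} | i j. hull_edge p i j}"
    have "F = \<Inter>?\<F>" unfolding F_def ax by auto
    moreover have "\<Inter>?\<F> face_of Yset p"
    proof (rule face_of_Inter)
      fix C assume "C \<in> ?\<F>"
      then show "C face_of Yset p"
      proof (elim insertE CollectE exE conjE)
        fix i j assume C: "C = Yset p \<inter> {d. axis (i, j) 1 \<bullet> d = 0}" "hull_edge p i j"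
        show ?thesis unfolding C(1)
          by (rule face_of_Int_supporting_hyperplane_le[OF cv]) (use C(2) in \<open>auto simp: ax Yset_def hull_edge_def\<close>)
      qed (simp add: face_of_refl[OF cv])
    qed simp
    ultimately show ?thesis by simp
  qed
  have "G \<subseteq> F" if G: "G face_of Yset p" "bounded G" for G
  proof -
    have "compact G" using G face_of_imp_closed[OF cv cl] compact_eq_bounded_closed by blast
    moreover have "convex G" using G(1) face_of_imp_convex by blast
    ultimately have "G = convex hull {x. x extreme_point_of G}" by (intro Krein_Milman_Minkowski)
    moreover have "{x. x extreme_point_of G} \<subseteq> F"
      using extF extreme_point_of_face[OF G(1)] by blast
    moreover have "convex F" using faceF face_of_imp_convex by blast
    ultimately show ?thesis using hull_minimal[of "{x. x extreme_point_of G}" F convex] by simp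
  qed
  then have maximal: "\<forall>G. G face_of Yset p \<and> bounded G \<longrightarrow> G \<subseteq> F" by blast
  show ?thesis
    unfolding f_def
    by (intro conjI simple affine_map_dmap bij_betw_dmap_Xbar[OF assms(1-3)] faceF maximal
        bounded_hull_face[OF assms(1-3), folded F_def] bij_betw_dmap_Xf[OF assms(1-3), folded F_def])
qed

end
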